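(* Let $f:\mathbb{R}^d\to\mathbb{R}$ be differentiable, $\mu$-strongly convex with $\mu>0$, and $\mathbf{L}$-smooth with a symmetric positive definite matrix $\mathbf{L}\succ0$; let $\psi:\mathbb{R}^d\to\mathbb{R}\cup\{+\infty\}$ be proper, closed and convex. Let $\omega\ge0$, let $\mathbf{\Omega}\succeq0$ be a symmetric positive semidefinite $d\times d$ matrix, let $\mathcal{C}_\omega\in\mathbb{B}^d(\omega)$ and $\mathcal{C}_{\mathbf{\Omega}}\in\mathbb{B}^d(\mathbf{\Omega})$ be compression operators, and put $$\widetilde{\mathbf{\Omega}}:=\mathbf{I}+\omega(\omega+2)\,\mathbf{\Omega}(\mathbf{I}+\mathbf{\Omega})^{-1}.$$ If the stepsize satisfies $0<\gamma\le\lambda_{\max}^{-1}(\mathbf{L}\widetilde{\mathbf{\Omega}})$, then the iterates of the GradSkip+ algorithm satisfy, for all $t\ge0$, $$\mathbb{E}[\Psi_t]\le\left(1-\min\{\gamma\mu,\delta\}\right)^t\Psi_0,$$ where $$\delta=1-\frac{1}{1+\lambda_{\min}(\mathbf{\Omega})}\left(1-\frac{1}{(1+\omega)^2}\right)\in[0,1],\qquad \Psi_t:=\|x_t-x_\star\|^2+\gamma^2(1+\omega)^2\|h_t-\nabla f(x_\star)\|^2 .$$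
   Context: Notation: $\mathbf{I}$ is the identity matrix; $\|x\|_{\mathbf{M}}^2:=x^\top\mathbf{M}x$; $\lambda_{\max},\lambda_{\min}$ denote largest and smallest eigenvalue (the eigenvalues of $\mathbf{L}\widetilde{\mathbf{\Omega}}$ are real and positive). $D_f(x,y):=f(x)-f(y)-\langle\nabla f(y),x-y\rangle$. The function $f$ is $\mu$-strongly convex if $D_f(x,y)\ge\frac{\mu}{2}\|x-y\|^2$ for all $x,y$, and $\mathbf{L}$-smooth if $D_f(x,y)\le\frac12\|x-y\|_{\mathbf{L}}^2$ for all $x,y$. $\mathrm{prox}_{g}(x):=\arg\min_{u}\{g(u)+\frac12\|u-x\|^2\}$. The point $x_\star$ is the unique minimizer of $f+\psi$. Compressors: for symmetric $\mathbf{\Omega}\succeq0$, $\mathbb{B}^d(\mathbf{\Omega})$ is the class of (possibly randomized) operators $\mathcal{C}:\mathbb{R}^d\to\mathbb{R}^d$ with $\mathbb{E}[\mathcal{C}(x)]=x$ and $\mathbb{E}\left[\|(\mathbf{I}+\mathbf{\Omega})^{-1}\mathcal{C}(x)\|^2\right]\le\|x\|^2_{(\mathbf{I}+\mathbf{\Omega})^{-1}}$ for all $x\in\mathbb{R}^d$. For a scalar $\omega\ge0$, $\mathbb{B}^d(\omega)$ is the class of (possibly randomized) $\mathcal{C}$ with $\mathbb{E}[\mathcal{C}(x)]=x$ and $\mathbb{E}[\|\mathcal{C}(x)\|^2]\le(1+\omega)\|x\|^2$ for all $x$. GradSkip+ algorithm. Input: stepsize $\gamma>0$, $\mathcal{C}_\omega\in\mathbb{B}^d(\omega)$,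 $\mathcal{C}_{\mathbf{\Omega}}\in\mathbb{B}^d(\mathbf{\Omega})$, deterministic $x_0,h_0\in\mathbb{R}^d$. Each application of a compressor uses fresh randomness independent of everything before. For $t=0,1,2,\dots$: (1) $\hat h_{t+1}=\nabla f(x_t)-(\mathbf{I}+\mathbf{\Omega})^{-1}\mathcal{C}_{\mathbf{\Omega}}(\nabla f(x_t)-h_t)$; (2) $\hat x_{t+1}=x_t-\gamma(\nabla f(x_t)-\hat h_{t+1})$; (3) $\hat g_t=\frac{1}{\gamma(1+\omega)}\mathcal{C}_\omega\left(\hat x_{t+1}-\mathrm{prox}_{\gamma(1+\omega)\psi}(\hat x_{t+1}-\gamma(1+\omega)\hat h_{t+1})\right)$; (4) $x_{t+1}=\hat x_{t+1}-\gamma\hat g_t$; (5) $h_{t+1}=\hat h_{t+1}+\frac{1}{\gamma(1+\omega)}(x_{t+1}-\hat x_{t+1})$. *)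

theory Defs
  imports "HOL-Probability.Probability"
begin

section \<open>Matrices\<close>

definition symmetric_matrix :: "real^'n^'n \<Rightarrow> bool" where
  "symmetric_matrix M \<longleftrightarrow> transpose M = M"

definition pos_semidef :: "real^'n^'n \<Rightarrow> bool" where
  "pos_semidef M \<longleftrightarrow> symmetric_matrix M \<and> (\<forall>x. 0 \<le> x \<bullet> (M *v x))"

definition pos_def :: "real^'n^'n \<Rightarrow> bool" where
  "pos_def M \<longleftrightarrow> symmetric_matrix M \<and> (\<forall>x. x \<noteq> 0 \<longrightarrow> 0 < x \<bullet> (M *v x))"

definition mat_norm_sq :: "real^'n^'n \<Rightarrow> real^'n \<Rightarrow> real" where
  "mat_norm_sq M x = x \<bullet> (M *v x)"

text \<open>Only real eigenvalues are collected. The two extremal eigenvalues below are used for matrices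
  whose spectrum is real: a symmetric matrix, and a product of two positive definite matrices.\<close>

definition eigenvalues :: "real^'n^'n \<Rightarrow> real set" where
  "eigenvalues M = {c. \<exists>v. v \<noteq> 0 \<and> M *v v = c *\<^sub>R v}"

definition lambda_max :: "real^'n^'n \<Rightarrow> real" where
  "lambda_max M = Max (eigenvalues M)"

definition lambda_min :: "real^'n^'n \<Rightarrow> real" where
  "lambda_min M = Min (eigenvalues M)"

definition Omega_tilde :: "real \<Rightarrow> real^'n^'n \<Rightarrow> real^'n^'n" where
  "Omega_tilde \<omega> \<Omega> = mat 1 + (\<omega> * (\<omega> + 2)) *\<^sub>R (\<Omega> ** matrix_inv (mat 1 + \<Omega>))"


section \<open>Smooth and convex functions\<close>

definition grad :: "('a::real_inner \<Rightarrow> real) \<Rightarrow> 'a \<Rightarrow> 'a" where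
  "grad f x = (THE D. GDERIV f x :> D)"

definition bregman :: "('a::real_inner \<Rightarrow> real) \<Rightarrow> 'a \<Rightarrow> 'a \<Rightarrow> real" where
  "bregman f x y = f x - f y - grad f y \<bullet> (x - y)"

definition strongly_convex :: "real \<Rightarrow> ('a::real_inner \<Rightarrow> real) \<Rightarrow> bool" where
  "strongly_convex \<mu> f \<longleftrightarrow> (\<forall>x y. \<mu> / 2 * (norm (x - y))\<^sup>2 \<le> bregman f x y)"

definition matrix_smooth :: "real^'n^'n \<Rightarrow> (real^'n \<Rightarrow> real) \<Rightarrow> bool" where
  "matrix_smooth L f \<longleftrightarrow> (\<forall>x y. bregman f x y \<le> 1 / 2 * mat_norm_sq L (x - y))"

text \<open>An extended-valued function is closed (resp. convex) iff its epigraph, a subset of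
  \<open>\<real>\<^sup>d \<times> \<real>\<close>, is closed (resp. convex).\<close>

definition ereal_epigraph :: "('a \<Rightarrow> ereal) \<Rightarrow> ('a \<times> real) set" where
  "ereal_epigraph g = {(x, r). g x \<le> ereal r}"

definition proper_closed_convex :: "('a::euclidean_space \<Rightarrow> ereal) \<Rightarrow> bool" where
  "proper_closed_convex g \<longleftrightarrow>
     (\<forall>x. g x \<noteq> -\<infinity>) \<and> (\<exists>x. g x \<noteq> \<infinity>) \<and>
     closed (ereal_epigraph g) \<and> convex (ereal_epigraph g)"

definition prox :: "('a::euclidean_space \<Rightarrow> ereal) \<Rightarrow> 'a \<Rightarrow> 'a" where
  "prox g x = arg_min (\<lambda>u. g u + ereal (1 / 2 * (norm (u - x))\<^sup>2)) (\<lambda>_. True)"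

definition composite_minimizer :: "('a::euclidean_space \<Rightarrow> real) \<Rightarrow> ('a \<Rightarrow> ereal) \<Rightarrow> 'a" where
  "composite_minimizer f \<psi> = arg_min (\<lambda>x. ereal (f x) + \<psi> x) (\<lambda>_. True)"


section \<open>Compressors\<close>

text \<open>A randomized operator on \<open>\<real>\<^sup>d\<close> is given by a probability space \<open>S\<close> of seeds together with a map
  \<open>C\<close>; the output on input \<open>x\<close> is the random vector \<open>C s x\<close> with \<open>s\<close> drawn from \<open>S\<close>. Joint
  measurability makes the output a random vector also when the input is random.\<close>

definition random_operator :: "'s measure \<Rightarrow> ('s \<Rightarrow> real^'n \<Rightarrow> real^'n) \<Rightarrow> bool" where
  "random_operator S C \<longleftrightarrow>
     prob_space S \<and> (\<lambda>(s, x). C s x) \<in> borel_measurable (S \<Otimes>\<^sub>M borel)"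

definition unbiased :: "'s measure \<Rightarrow> ('s \<Rightarrow> real^'n \<Rightarrow> real^'n) \<Rightarrow> bool" where
  "unbiased S C \<longleftrightarrow> (\<forall>x. has_bochner_integral S (\<lambda>s. C s x) x)"

text \<open>Integrability is stated explicitly, because the Bochner integral of a non-integrable function
  is \<open>0\<close>.\<close>

definition scalar_compressor :: "real \<Rightarrow> 's measure \<Rightarrow> ('s \<Rightarrow> real^'n \<Rightarrow> real^'n) \<Rightarrow> bool" where
  "scalar_compressor \<omega> S C \<longleftrightarrow>
     random_operator S C \<and> unbiased S C \<and>
     (\<forall>x. integrable S (\<lambda>s. (norm (C s x))\<^sup>2) \<and>
          (\<integral>s. (norm (C s x))\<^sup>2 \<partial>S) \<le> (1 + \<omega>) * (norm x)\<^sup>2)"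

definition matrix_compressor :: "real^'n^'n \<Rightarrow> 's measure \<Rightarrow> ('s \<Rightarrow> real^'n \<Rightarrow> real^'n) \<Rightarrow> bool" where
  "matrix_compressor \<Omega> S C \<longleftrightarrow>
     random_operator S C \<and> unbiased S C \<and>
     (\<forall>x. integrable S (\<lambda>s. (norm (matrix_inv (mat 1 + \<Omega>) *v C s x))\<^sup>2) \<and>
          (\<integral>s. (norm (matrix_inv (mat 1 + \<Omega>) *v C s x))\<^sup>2 \<partial>S)
            \<le> mat_norm_sq (matrix_inv (mat 1 + \<Omega>)) x)"

text \<open>\<open>\<xi> t\<close> and \<open>\<zeta> t\<close> are the seeds of the two compressors in iteration \<open>t\<close>. The law of the pair
  is the product \<open>R \<Otimes>\<^sub>M S\<close>, so \<open>\<xi> t\<close> has law \<open>R\<close>, \<open>\<zeta> t\<close> has law \<open>S\<close> and the two are independent;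
  together with the independence of the pairs for different \<open>t\<close>, the whole family of seeds is mutually
  independent. (Pairing is used because \<open>indep_vars\<close> needs a single value type.)\<close>

definition fresh_seeds ::
  "'w measure \<Rightarrow> 'r measure \<Rightarrow> 's measure \<Rightarrow> (nat \<Rightarrow> 'w \<Rightarrow> 'r) \<Rightarrow> (nat \<Rightarrow> 'w \<Rightarrow> 's) \<Rightarrow> bool" where
  "fresh_seeds M R S \<xi> \<zeta> \<longleftrightarrow>
     prob_space M \<and>
     (\<forall>t. \<xi> t \<in> measurable M R \<and> \<zeta> t \<in> measurable M S \<and>
          distr M (R \<Otimes>\<^sub>M S) (\<lambda>w. (\<xi> t w, \<zeta> t w)) = R \<Otimes>\<^sub>M S) \<and>
     prob_space.indep_vars M (\<lambda>_. R \<Otimes>\<^sub>M S) (\<lambda>t w. (\<xi> t w, \<zeta> t w)) UNIV"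


section \<open>The GradSkip+ algorithm\<close>

text \<open>\<open>cw\<close> and \<open>c\<Omega>\<close> are the realizations of the two compressors drawn in the current iteration; the
  state is the pair \<open>(x, h)\<close>.\<close>

definition gradskip_step ::
  "(real^'n \<Rightarrow> real) \<Rightarrow> (real^'n \<Rightarrow> ereal) \<Rightarrow> real \<Rightarrow> real \<Rightarrow> real^'n^'n \<Rightarrow>
   (real^'n \<Rightarrow> real^'n) \<Rightarrow> (real^'n \<Rightarrow> real^'n) \<Rightarrow>
   (real^'n) \<times> (real^'n) \<Rightarrow> (real^'n) \<times> (real^'n)" where
  "gradskip_step f \<psi> \<gamma> \<omega> \<Omega> cw c\<Omega> = (\<lambda>(x, h).
     let h_hat = grad f x - matrix_inv (mat 1 + \<Omega>) *v c\<Omega> (grad f x - h);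
         x_hat = x - \<gamma> *\<^sub>R (grad f x - h_hat);
         g_hat = (1 / (\<gamma> * (1 + \<omega>))) *\<^sub>R
                   cw (x_hat - prox (\<lambda>u. ereal (\<gamma> * (1 + \<omega>)) * \<psi> u)
                                    (x_hat - (\<gamma> * (1 + \<omega>)) *\<^sub>R h_hat));
         x' = x_hat - \<gamma> *\<^sub>R g_hat;
         h' = h_hat + (1 / (\<gamma> * (1 + \<omega>))) *\<^sub>R (x' - x_hat)
     in (x', h'))"

primrec gradskip_plus ::
  "(real^'n \<Rightarrow> real) \<Rightarrow> (real^'n \<Rightarrow> ereal) \<Rightarrow> real \<Rightarrow> real \<Rightarrow> real^'n^'n \<Rightarrow>
   (nat \<Rightarrow> real^'n \<Rightarrow> real^'n) \<Rightarrow> (nat \<Rightarrow> real^'n \<Rightarrow> real^'n) \<Rightarrow>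
   real^'n \<Rightarrow> real^'n \<Rightarrow> nat \<Rightarrow> (real^'n) \<times> (real^'n)" where
  "gradskip_plus f \<psi> \<gamma> \<omega> \<Omega> cw c\<Omega> x0 h0 0 = (x0, h0)"
| "gradskip_plus f \<psi> \<gamma> \<omega> \<Omega> cw c\<Omega> x0 h0 (Suc t) =
     gradskip_step f \<psi> \<gamma> \<omega> \<Omega> (cw t) (c\<Omega> t) (gradskip_plus f \<psi> \<gamma> \<omega> \<Omega> cw c\<Omega> x0 h0 t)"

definition lyapunov ::
  "(real^'n \<Rightarrow> real) \<Rightarrow> (real^'n \<Rightarrow> ereal) \<Rightarrow> real \<Rightarrow> real \<Rightarrow> (real^'n) \<times> (real^'n) \<Rightarrow> real" where
  "lyapunov f \<psi> \<gamma> \<omega> = (\<lambda>(x, h).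
     (norm (x - composite_minimizer f \<psi>))\<^sup>2 +
     \<gamma>\<^sup>2 * (1 + \<omega>)\<^sup>2 * (norm (h - grad f (composite_minimizer f \<psi>)))\<^sup>2)"

end

theory Submission
  imports Defs
begin

text \<open>Write \<open>W = (I + \<Omega>)\<^sup>-\<^sup>1\<close>, \<open>u = \<nabla>f(x\<^sub>t) - \<nabla>f(x\<^sub>\<star>)\<close> and \<open>v = h\<^sub>t - \<nabla>f(x\<^sub>\<star>)\<close>. Averaging over \<open>C\<omega>\<close> and using
  that the proximal map is firmly nonexpansive bounds the next Lyapunov value by
  \<open>\<parallel>x\<^sub>t - x\<^sub>\<star> - \<gamma>u\<parallel>\<^sup>2 + \<gamma>\<^sup>2\<omega>(\<omega> + 2)\<parallel>hh - \<nabla>f(x\<^sub>\<star>)\<parallel>\<^sup>2\<close>, where \<open>hh\<close> is the intermediate shift; averaging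
  over \<open>C\<Omega>\<close> replaces the last squared norm by \<open>u \<bullet> u - u \<bullet> Wu + v \<bullet> Wv\<close>. The terms in \<open>u\<close> combine to
  \<open>\<gamma>\<^sup>2 u \<bullet> Omega_tilde u\<close>, which the stepsize condition and cocoercivity absorb, leaving the factor
  \<open>1 - \<gamma>\<mu>\<close>; the term in \<open>v\<close> is contracted by \<open>1 - \<delta>\<close>, since the eigenvalues of \<open>W\<close> are at most
  \<open>1 / (1 + lambda_min \<Omega>)\<close>.\<close>

section \<open>Symmetric matrices and extremal eigenvalues\<close>

lemma symmetric_matrix_inner:
  assumes "symmetric_matrix A"
  shows "(A *v x) \<bullet> y = x \<bullet> (A *v y)"
  using assms dot_lmul_matrix[of x A y] transpose_matrix_vector[of A x]
  by (simp add: symmetric_matrix_def)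

lemma symmetric_matrix_lincomb:
  assumes "symmetric_matrix A" "symmetric_matrix B"
  shows "symmetric_matrix (a *\<^sub>R A + b *\<^sub>R B)"
  using assms by (simp add: symmetric_matrix_def transpose_def vec_eq_iff)

lemma symmetric_matrix_mat [simp]: "symmetric_matrix (mat c)"
  by (simp add: symmetric_matrix_def)

lemma symmetric_matrixI:
  assumes "\<And>x y. (A *v x) \<bullet> y = x \<bullet> (A *v y)"
  shows "symmetric_matrix A"
proof -
  have "transpose A *v x = A *v x" for x
    by (metis assms dot_lmul_matrix transpose_matrix_vector vector_eq_rdot)
  then show ?thesis
    by (simp add: symmetric_matrix_def matrix_eq)
qed

text \<open>A nonzero \<open>A *v u\<close> would be a descent direction: along
  \<open>u + t *\<^sub>R w\<close> the form starts at 0 with first-order term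
  \<open>2 * t * (w \<bullet> w)\<close>, so a small negative \<open>t\<close> makes it
  negative.\<close>

lemma symmetric_psd_eq_zero:
  assumes sym: "symmetric_matrix A" and psd: "\<And>x. 0 \<le> x \<bullet> (A *v x)" and "u \<bullet> (A *v u) = 0"
  shows "A *v u = 0"
proof (rule ccontr)
  define w where "w = A *v u"
  define K where "K = w \<bullet> (A *v w)"
  \<comment> \<open>The 1 in the denominator covers \<open>K = 0\<close>; this length gives
    \<open>- (t * K) < w \<bullet> w\<close>, so the linear term dominates.\<close>
  define t where "t = - (w \<bullet> w) / (1 + K)"
  assume "A *v u \<noteq> 0"
  then have w: "0 < w \<bullet> w" by (simp add: w_def)
  have K: "0 \<le> K" by (simp add: K_def psd)
  have "0 \<le> (u + t *\<^sub>R w) \<bullet> (A *v (u + t *\<^sub>R w))" by (rule psd)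
  also have "\<dots> = t * (2 * (w \<bullet> w) + t * K)"
    using assms(3) symmetric_matrix_inner[OF sym, of u w]
    by (simp add: matrix_vector_right_distrib matrix_vector_mult_scaleR inner_add_left inner_add_right
        K_def algebra_simps flip: w_def)
  also have "\<dots> < 0"
  proof (rule mult_neg_pos)
    show "t < 0" using w K by (simp add: t_def divide_neg_pos)
    have "- (t * K) < w \<bullet> w" using w K by (simp add: t_def field_simps)
    then show "0 < 2 * (w \<bullet> w) + t * K" using w by linarith
  qed
  finally show False by simp
qed

lemma pos_def_inj:
  assumes "pos_def B" "B *v x = B *v y"
  shows "x = y"
proof (rule ccontr)
  assume "x \<noteq> y"
  then have "0 < (x - y) \<bullet> (B *v (x - y))" using assms(1) by (simp add: pos_def_def)
  then show False using assms(2) by (simp add: matrix_vector_mult_diff_distrib)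
qed

text \<open>\<open>lambda_max\<close> and \<open>lambda_min\<close> are a \<open>Max\<close> and a
  \<open>Min\<close>, informative only for finite sets. Eigenvectors of distinct eigenvalues are
  linearly independent, which bounds their number by the dimension.\<close>

lemma finite_eigenvalues: "finite (eigenvalues A)" for A :: "real^'n^'n"
proof -
  have "\<forall>c\<in>eigenvalues A. \<exists>v. v \<noteq> 0 \<and> A *v v = c *\<^sub>R v"
    by (auto simp: eigenvalues_def)
  from bchoice[OF this] obtain v
    where v: "\<And>c. c \<in> eigenvalues A \<Longrightarrow> v c \<noteq> 0 \<and> A *v v c = c *\<^sub>R v c"
    by blast
  have zero: "\<forall>c\<in>\<Lambda>. a c = 0"
    if "finite \<Lambda>" "\<Lambda> \<subseteq> eigenvalues A" "(\<Sum>c\<in>\<Lambda>. a c *\<^sub>R v c) = 0" for \<Lambda> a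
    using that
  proof (induction \<Lambda> arbitrary: a rule: finite_induct)
    case (insert b \<Lambda>)
    have eq: "a b *\<^sub>R v b + (\<Sum>c\<in>\<Lambda>. a c *\<^sub>R v c) = 0"
      using insert by simp
    \<comment> \<open>This is A - b I applied to the sum over \<open>\<Lambda>\<close>. It vanishes
      because that sum is a multiple of \<open>v b\<close>, so the induction hypothesis applies to
      the coefficients \<open>a c * (c - b)\<close>.\<close>
    have "(\<Sum>c\<in>\<Lambda>. (a c * (c - b)) *\<^sub>R v c) = (\<Sum>c\<in>\<Lambda>. a c *\<^sub>R (A *v v c)) - b *\<^sub>R (\<Sum>c\<in>\<Lambda>. a c *\<^sub>R v c)"
      unfolding scaleR_sum_right sum_subtractf[symmetric]
    proof (rule sum.cong)
      fix c assume "c \<in> \<Lambda>"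
      then have "A *v v c = c *\<^sub>R v c" using insert.prems v by blast
      then show "(a c * (c - b)) *\<^sub>R v c = a c *\<^sub>R (A *v v c) - b *\<^sub>R a c *\<^sub>R v c"
        by (simp add: algebra_simps)
    qed simp
    also have "(\<Sum>c\<in>\<Lambda>. a c *\<^sub>R (A *v v c)) = A *v (\<Sum>c\<in>\<Lambda>. a c *\<^sub>R v c)"
      by (simp add: linear_sum[OF matrix_vector_mul_linear] matrix_vector_mult_scaleR)
    also have "(\<Sum>c\<in>\<Lambda>. a c *\<^sub>R v c) = - a b *\<^sub>R v b"
      using eq by (simp add: eq_neg_iff_add_eq_0 add.commute)
    also have "A *v (- a b *\<^sub>R v b) - b *\<^sub>R (- a b *\<^sub>R v b) = 0"
      using insert.prems v[of b] by (simp only: matrix_vector_mult_scaleR) simp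
    finally have "\<forall>c\<in>\<Lambda>. a c * (c - b) = 0"
      using insert by (intro insert.IH) auto
    with insert.hyps have *: "\<forall>c\<in>\<Lambda>. a c = 0" by auto
    with eq insert.prems v[of b] show ?case by simp
  qed simp
  have "inj_on v (eigenvalues A)"
  proof (rule inj_onI)
    fix c c' assume "c \<in> eigenvalues A" "c' \<in> eigenvalues A" "v c = v c'"
    then have "c *\<^sub>R v c = c' *\<^sub>R v c" "v c \<noteq> 0" using v by metis+
    then show "c = c'" by simp
  qed
  have "card \<Lambda> \<le> DIM(real^'n)" if \<Lambda>: "finite \<Lambda>" "\<Lambda> \<subseteq> eigenvalues A" for \<Lambda>
  proof -
    have inj: "inj_on v \<Lambda>" using \<open>inj_on v (eigenvalues A)\<close> \<Lambda> inj_on_subset by blast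
    have "independent (v ` \<Lambda>)"
    proof (rule independent_if_scalars_zero)
      fix g x assume "(\<Sum>x\<in>v ` \<Lambda>. g x *\<^sub>R x) = 0" "x \<in> v ` \<Lambda>"
      then show "g x = 0" using zero[OF \<Lambda>, of "g \<circ> v"] inj by (auto simp: sum.reindex)
    qed (use \<Lambda> in simp)
    then show ?thesis using independent_bound[of "v ` \<Lambda>"] card_image[OF inj] by simp
  qed
  then show ?thesis
    using finite_if_finite_subsets_card_bdd[of "eigenvalues A" "DIM(real^'n)"] by blast
qed

text \<open>The vector \<open>u\<close> maximizes the quotient of the two forms on the unit sphere.
  With \<open>c\<close> the maximum, the form of c B - A is nonnegative and vanishes at
  \<open>u\<close>, so \<open>u\<close> lies in the kernel.\<close>

lemma generalized_rayleigh:
  fixes A B :: "real^'n^'n"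
  assumes A: "symmetric_matrix A" and B: "pos_def B"
  obtains u c where "u \<noteq> 0" "A *v u = c *\<^sub>R (B *v u)" "\<And>x. x \<bullet> (A *v x) \<le> c * (x \<bullet> (B *v x))"
proof -
  define q where "q x = (x \<bullet> (A *v x)) / (x \<bullet> (B *v x))" for x
  have pos: "0 < x \<bullet> (B *v x)" if "x \<noteq> 0" for x
    using B that by (simp add: pos_def_def)
  have "sphere (0::real^'n) 1 \<noteq> {}" by simp
  moreover have "continuous_on (sphere 0 1) q"
    unfolding q_def by (intro continuous_intros) (metis mem_sphere_0 norm_zero pos zero_neq_one less_irrefl)
  ultimately obtain u where u: "u \<in> sphere 0 1" and max: "\<And>y. y \<in> sphere 0 1 \<Longrightarrow> q y \<le> q u"
    using continuous_attains_sup[OF compact_sphere] by blast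
  have u0: "u \<noteq> 0" using u by auto
  have le: "x \<bullet> (A *v x) \<le> q u * (x \<bullet> (B *v x))" for x
  proof (cases "x = 0")
    case False
    have "q (x /\<^sub>R norm x) = q x"
      using False by (simp add: q_def matrix_vector_mult_scaleR)
    then have "q x \<le> q u" using max[of "x /\<^sub>R norm x"] False by simp
    then show ?thesis using pos[OF False] by (simp add: q_def[of x] divide_le_eq)
  qed simp
  define C where "C = q u *\<^sub>R B + (-1) *\<^sub>R A"
  have Cv: "C *v x = q u *\<^sub>R (B *v x) - A *v x" for x
    by (simp add: C_def matrix_vector_mult_add_rdistrib scaleR_matrix_vector_assoc[symmetric]
        matrix_vector_mult_diff_rdistrib)
  have "C *v u = 0"
  proof (rule symmetric_psd_eq_zero)
    show "symmetric_matrix C"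
      unfolding C_def using A B by (intro symmetric_matrix_lincomb) (auto simp: pos_def_def)
    show "0 \<le> x \<bullet> (C *v x)" for x using le[of x] by (simp add: Cv inner_diff_right)
    show "u \<bullet> (C *v u) = 0" using pos[OF u0] by (simp add: Cv inner_diff_right q_def)
  qed
  then have "A *v u = q u *\<^sub>R (B *v u)" by (simp add: Cv)
  with u0 le show ?thesis using that by blast
qed

text \<open>\<open>L ** B\<close> need not be symmetric, so the quotient is taken for
  \<open>B ** L ** B\<close> against \<open>B\<close>. Cancelling the injective \<open>B\<close>
  from the generalized eigenvector equation leaves an eigenvector of \<open>L ** B\<close>.\<close>

lemma lambda_max_product_bound:
  assumes L: "pos_def L" and B: "pos_def B"
  shows "(B *v x) \<bullet> (L *v (B *v x)) \<le> lambda_max (L ** B) * (x \<bullet> (B *v x))"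
proof -
  have symL: "symmetric_matrix L" and symB: "symmetric_matrix B"
    using L B by (auto simp: pos_def_def)
  have BLB: "(B ** L ** B) *v x = B *v (L *v (B *v x))" for x
    by (simp add: matrix_vector_mul_assoc matrix_mul_assoc)
  have "symmetric_matrix (B ** L ** B)"
    by (rule symmetric_matrixI) (simp add: BLB symmetric_matrix_inner[OF symL] symmetric_matrix_inner[OF symB])
  then obtain u c where u: "u \<noteq> 0" and eig: "(B ** L ** B) *v u = c *\<^sub>R (B *v u)"
    and le: "\<And>x. x \<bullet> ((B ** L ** B) *v x) \<le> c * (x \<bullet> (B *v x))"
    using generalized_rayleigh[OF _ B] by blast
  have "B *v (L *v (B *v u)) = B *v (c *\<^sub>R u)"
    using eig by (simp only: BLB matrix_vector_mult_scaleR)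
  then have "(L ** B) *v u = c *\<^sub>R u"
    by (metis pos_def_inj[OF B] matrix_vector_mul_assoc)
  then have "c \<in> eigenvalues (L ** B)" using u by (auto simp: eigenvalues_def)
  then have "c \<le> lambda_max (L ** B)"
    unfolding lambda_max_def by (intro Max_ge finite_eigenvalues)
  moreover have "0 \<le> x \<bullet> (B *v x)" using B by (cases "x = 0") (auto simp: pos_def_def less_imp_le)
  ultimately have "c * (x \<bullet> (B *v x)) \<le> lambda_max (L ** B) * (x \<bullet> (B *v x))"
    by (rule mult_right_mono)
  with le[of x] show ?thesis by (simp add: BLB symmetric_matrix_inner[OF symB])
qed

text \<open>Maximizing the form of \<open>- \<Omega>\<close> against the identity minimizes that of
  \<open>\<Omega>\<close>. The extremal vector also shows that \<open>eigenvalues \<Omega>\<close>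
  is nonempty, so that the \<open>Min\<close> is itself an eigenvalue.\<close>

lemma lambda_min_psd:
  fixes \<Omega> :: "real^'n^'n"
  assumes "pos_semidef \<Omega>"
  shows "0 \<le> lambda_min \<Omega>" "lambda_min \<Omega> * (x \<bullet> x) \<le> x \<bullet> (\<Omega> *v x)"
proof -
  have sym: "symmetric_matrix (- \<Omega>)"
    using assms symmetric_matrix_lincomb[of \<Omega> \<Omega> "-1" 0] by (simp add: pos_semidef_def)
  have neg: "(- \<Omega>) *v x = - (\<Omega> *v x)" for x
    using scaleR_matrix_vector_assoc[of "-1" \<Omega> x] by simp
  obtain u c where u: "u \<noteq> 0" and eig: "- (\<Omega> *v u) = c *\<^sub>R u"
    and le: "\<And>x. - (x \<bullet> (\<Omega> *v x)) \<le> c * (x \<bullet> x)"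
    using generalized_rayleigh[OF sym, of "mat 1"]
    by (auto simp: neg pos_def_def)
  have "\<Omega> *v u = (- c) *\<^sub>R u" using eig by (metis minus_equation_iff scaleR_minus_left)
  then have mem: "- c \<in> eigenvalues \<Omega>" using u unfolding eigenvalues_def by blast
  have "lambda_min \<Omega> \<le> - c"
    unfolding lambda_min_def by (intro Min_le finite_eigenvalues mem)
  then have "lambda_min \<Omega> * (x \<bullet> x) \<le> - c * (x \<bullet> x)" by (intro mult_right_mono) auto
  with le[of x] show "lambda_min \<Omega> * (x \<bullet> x) \<le> x \<bullet> (\<Omega> *v x)" by simp
  have "lambda_min \<Omega> \<in> eigenvalues \<Omega>"
    unfolding lambda_min_def using mem by (intro Min_in finite_eigenvalues) auto
  then obtain v where "v \<noteq> 0" "\<Omega> *v v = lambda_min \<Omega> *\<^sub>R v" by (auto simp: eigenvalues_def)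
  moreover have "0 \<le> v \<bullet> (\<Omega> *v v)" using assms by (simp add: pos_semidef_def)
  ultimately have "0 < v \<bullet> v" "0 \<le> lambda_min \<Omega> * (v \<bullet> v)" by simp_all
  then show "0 \<le> lambda_min \<Omega>" by (metis zero_le_mult_iff not_le)
qed

section \<open>The resolvent of \<open>\<Omega>\<close> and the matrix
  \<open>Omega_tilde\<close>\<close>

lemma resolvent_apply:
  fixes \<Omega> :: "real^'n^'n"
  assumes "pos_semidef \<Omega>"
  shows "matrix_inv (mat 1 + \<Omega>) *v x + \<Omega> *v (matrix_inv (mat 1 + \<Omega>) *v x) = x"
proof -
  have "x = 0" if "(mat 1 + \<Omega>) *v x = 0" for x
  proof -
    have "x \<bullet> x + x \<bullet> (\<Omega> *v x) = 0"
      using that by (metis inner_add_right inner_zero_right matrix_vector_mul_lid matrix_vector_mult_add_rdistrib)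
    moreover have "0 \<le> x \<bullet> (\<Omega> *v x)" using assms by (simp add: pos_semidef_def)
    ultimately have "x \<bullet> x \<le> 0" by linarith
    then show "x = 0" by (metis inner_eq_zero_iff inner_ge_zero antisym)
  qed
  then have "invertible (mat 1 + \<Omega>)"
    by (simp add: invertible_left_inverse matrix_left_invertible_ker)
  \<comment> \<open>\<open>matrix_inv\<close> is a choice, so its defining equation is available
    only after invertibility.\<close>
  then have "(mat 1 + \<Omega>) ** matrix_inv (mat 1 + \<Omega>) = mat 1"
    unfolding invertible_def matrix_inv_def by (rule someI2_ex) simp
  then have "(mat 1 + \<Omega>) *v (matrix_inv (mat 1 + \<Omega>) *v x) = x"
    by (simp add: matrix_vector_mul_assoc)
  then show ?thesis by (simp add: matrix_vector_mult_add_rdistrib)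
qed

lemma resolvent_symmetric:
  fixes \<Omega> :: "real^'n^'n"
  assumes "pos_semidef \<Omega>"
  shows "symmetric_matrix (matrix_inv (mat 1 + \<Omega>))"
proof (rule symmetric_matrixI)
  fix x y :: "real^'n"
  let ?W = "matrix_inv (mat 1 + \<Omega>)"
  have sym: "symmetric_matrix \<Omega>" using assms by (simp add: pos_semidef_def)
  have "(?W *v x) \<bullet> y = (?W *v x) \<bullet> (?W *v y + \<Omega> *v (?W *v y))"
    by (simp add: resolvent_apply[OF assms])
  also have "\<dots> = (?W *v x + \<Omega> *v (?W *v x)) \<bullet> (?W *v y)"
    by (simp add: inner_add_left inner_add_right symmetric_matrix_inner[OF sym])
  finally show "(?W *v x) \<bullet> y = x \<bullet> (?W *v y)"
    by (simp add: resolvent_apply[OF assms])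
qed

text \<open>With x = y + \<Omega> y, the product \<open>x \<bullet> y\<close> dominates
  \<open>(1 + lambda_min \<Omega>) * (y \<bullet> y)\<close>. Multiplying Cauchy-Schwarz by 1 +
  \<open>lambda_min \<Omega>\<close> and cancelling one factor \<open>x \<bullet> y\<close> gives
  the second bound; the first follows from it.\<close>

lemma resolvent_bounds:
  fixes \<Omega> :: "real^'n^'n"
  assumes "pos_semidef \<Omega>"
  defines "W \<equiv> matrix_inv (mat 1 + \<Omega>)"
  shows "x \<bullet> (W *v x) \<le> x \<bullet> x"
    and "(1 + lambda_min \<Omega>) * (x \<bullet> (W *v x)) \<le> x \<bullet> x"
proof -
  define y where "y = W *v x"
  have x: "x = y + \<Omega> *v y" using resolvent_apply[OF assms(1), of x] by (simp add: y_def W_def)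
  have min: "0 \<le> lambda_min \<Omega>" "lambda_min \<Omega> * (y \<bullet> y) \<le> y \<bullet> (\<Omega> *v y)"
    using lambda_min_psd[OF assms(1)] by auto
  have psd: "0 \<le> y \<bullet> (\<Omega> *v y)" using assms(1) by (simp add: pos_semidef_def)
  have xy: "x \<bullet> y = y \<bullet> y + y \<bullet> (\<Omega> *v y)" by (simp add: x inner_add_left inner_add_right inner_commute)
  have yx: "(1 + lambda_min \<Omega>) * (y \<bullet> y) \<le> x \<bullet> y" using min xy by (simp add: algebra_simps)
  show bd: "(1 + lambda_min \<Omega>) * (x \<bullet> (W *v x)) \<le> x \<bullet> x"
  proof (cases "x \<bullet> y = 0")
    case False
    then have pos: "0 < x \<bullet> y" using xy psd by (smt (verit) inner_ge_zero)
    have "(1 + lambda_min \<Omega>) * (x \<bullet> y) * (x \<bullet> y) \<le> (1 + lambda_min \<Omega>) * ((x \<bullet> x) * (y \<bullet> y))"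
      using Cauchy_Schwarz_ineq[of x y] min(1)
      by (simp only: mult.assoc) (simp add: power2_eq_square mult_left_mono)
    also have "\<dots> = (x \<bullet> x) * ((1 + lambda_min \<Omega>) * (y \<bullet> y))" by simp
    also have "\<dots> \<le> (x \<bullet> x) * (x \<bullet> y)" by (intro mult_left_mono yx) simp
    finally show ?thesis using pos by (simp flip: y_def)
  qed (simp flip: y_def)
  have "1 * (x \<bullet> (W *v x)) \<le> (1 + lambda_min \<Omega>) * (x \<bullet> (W *v x))"
    using min(1) xy psd by (intro mult_right_mono) (auto simp flip: y_def)
  with bd show "x \<bullet> (W *v x) \<le> x \<bullet> x" by linarith
qed

text \<open>The product of \<open>\<Omega>\<close> with its resolvent is the identity minus the
  resolvent; in this form the resolvent bounds apply to \<open>Omega_tilde\<close> directly.\<close>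

lemma Omega_tilde_apply:
  assumes "pos_semidef \<Omega>"
  shows "Omega_tilde \<omega> \<Omega> *v x = x + (\<omega> * (\<omega> + 2)) *\<^sub>R (x - matrix_inv (mat 1 + \<Omega>) *v x)"
proof -
  have "(\<Omega> ** matrix_inv (mat 1 + \<Omega>)) *v x = x - matrix_inv (mat 1 + \<Omega>) *v x"
    using resolvent_apply[OF assms, of x] by (metis add_diff_cancel_left' matrix_vector_mul_assoc)
  then show ?thesis
    by (simp add: Omega_tilde_def matrix_vector_mult_add_rdistrib scaleR_matrix_vector_assoc[symmetric])
qed

lemma Omega_tilde_pos_def:
  fixes \<Omega> :: "real^'n^'n"
  assumes "pos_semidef \<Omega>" "0 \<le> \<omega>"
  shows "pos_def (Omega_tilde \<omega> \<Omega>)"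
  unfolding pos_def_def
proof (intro conjI allI impI)
  note sym = symmetric_matrix_inner[OF resolvent_symmetric[OF assms(1)]]
  show "symmetric_matrix (Omega_tilde \<omega> \<Omega>)"
    by (rule symmetric_matrixI)
      (simp add: Omega_tilde_apply[OF assms(1)] inner_add_left inner_add_right inner_diff_left
        inner_diff_right sym)
  fix x :: "real^'n" assume "x \<noteq> 0"
  moreover have "0 \<le> (\<omega> * (\<omega> + 2)) * (x \<bullet> x - x \<bullet> (matrix_inv (mat 1 + \<Omega>) *v x))"
    using assms resolvent_bounds(1)[OF assms(1), of x] by simp
  ultimately show "0 < x \<bullet> (Omega_tilde \<omega> \<Omega> *v x)"
    by (simp add: Omega_tilde_apply[OF assms(1)] inner_add_right inner_diff_right add_pos_nonneg)
qed

section \<open>Gradients and Bregman divergences\<close>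

lemma GDERIV_unique:
  assumes "GDERIV f x :> D" "GDERIV f x :> E"
  shows "D = E"
proof -
  have "(\<lambda>h. h \<bullet> D) = (\<lambda>h. h \<bullet> E)"
    using assms unfolding gderiv_def by (rule has_derivative_unique)
  then show ?thesis by (metis vector_eq_ldot)
qed

lemma grad_eqI: "GDERIV f x :> D \<Longrightarrow> grad f x = D"
  unfolding grad_def by (blast intro: the_equality GDERIV_unique)

lemma GDERIV_grad:
  fixes f :: "'a::euclidean_space \<Rightarrow> real"
  assumes "f differentiable (at x)"
  shows "GDERIV f x :> grad f x"
proof -
  obtain f' where f': "(f has_derivative f') (at x)"
    using assms by (auto simp: differentiable_def)
  have lin: "linear f'" using f' by (rule has_derivative_linear)
  define D where "D = (\<Sum>b\<in>Basis. f' b *\<^sub>R b)"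
  have "f' h = h \<bullet> D" for h
  proof -
    have "f' h = f' (\<Sum>b\<in>Basis. (h \<bullet> b) *\<^sub>R b)" by (simp add: euclidean_representation)
    also have "\<dots> = (\<Sum>b\<in>Basis. (h \<bullet> b) * f' b)"
      by (simp add: linear_sum[OF lin] linear_scale[OF lin])
    finally show ?thesis by (simp add: D_def inner_sum_right mult.commute)
  qed
  then have "f' = (\<lambda>h. h \<bullet> D)" by (rule ext)
  then have "GDERIV f x :> D"
    using f' by (simp add: gderiv_def)
  then show ?thesis using grad_eqI by metis
qed

lemma bregman_three_point:
  "bregman f z y = bregman f z x + bregman f x y + (grad f x - grad f y) \<bullet> (z - x)"
  by (simp add: bregman_def algebra_simps inner_diff_left inner_diff_right)

lemma bregman_nonneg:
  assumes "strongly_convex \<mu> f" "0 \<le> \<mu>"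
  shows "0 \<le> bregman f x y"
proof -
  have "0 \<le> \<mu> / 2 * (norm (x - y))\<^sup>2" using assms by simp
  also have "\<dots> \<le> bregman f x y" using assms unfolding strongly_convex_def by blast
  finally show ?thesis .
qed

text \<open>Convexity gives \<open>0 \<le> bregman f (x - w) y\<close>. Optimizing over \<open>w\<close> would yield the usual bound by
  half the squared norm of the gradient difference in the metric of the inverse of \<open>L\<close>; keeping \<open>w\<close> free
  avoids inverting \<open>L\<close>.\<close>

lemma bregman_lower:
  assumes "strongly_convex \<mu> f" "0 \<le> \<mu>" "matrix_smooth L f"
  shows "(grad f x - grad f y) \<bullet> w - 1 / 2 * (w \<bullet> (L *v w)) \<le> bregman f x y"
proof -
  have "0 \<le> bregman f (x - w) y" using assms by (intro bregman_nonneg)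
  also have "\<dots> = bregman f (x - w) x + bregman f x y - (grad f x - grad f y) \<bullet> w"
    by (subst bregman_three_point[of f "x - w" y x]) simp
  also have "bregman f (x - w) x \<le> 1 / 2 * mat_norm_sq L (x - w - x)"
    using assms(3) unfolding matrix_smooth_def by blast
  also have "mat_norm_sq L (x - w - x) = w \<bullet> (L *v w)"
    by (simp add: mat_norm_sq_def matrix_vector_mult_scaleR[of L "-1" w, simplified])
  finally show ?thesis by simp
qed

text \<open>Serves the measurability of the iterates. With \<open>K\<close> bounding the operator
  norm of \<open>L\<close>, the divergence lies between \<open>(norm u)\<^sup>2 / (2 * K)\<close>
  and \<open>K / 2 * (norm (x - y))\<^sup>2\<close>, which makes the gradient
  \<open>K\<close>-Lipschitz.\<close>

lemma matrix_smooth_continuous_grad: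
  assumes sc: "strongly_convex \<mu> f" "0 \<le> \<mu>" and sm: "matrix_smooth L f"
  shows "continuous_on UNIV (grad f)"
proof -
  obtain K where K: "0 < K" and le: "\<And>w. norm (L *v w) \<le> norm w * K"
    using bounded_linear.pos_bounded[OF matrix_vector_mul_bounded_linear[of L]] by blast
  have quad: "w \<bullet> (L *v w) \<le> K * (norm w)\<^sup>2" for w
  proof -
    have "w \<bullet> (L *v w) \<le> norm w * norm (L *v w)" by (rule norm_cauchy_schwarz)
    also have "\<dots> \<le> norm w * (norm w * K)" by (intro mult_left_mono le) simp
    finally show ?thesis by (simp add: power2_eq_square ac_simps)
  qed
  have "norm (grad f x - grad f y) \<le> K * norm (x - y)" for x y
  proof -
    define u where "u = grad f x - grad f y"
    \<comment> \<open>The shift u / K maximizes the lower bound of \<open>bregman_lower\<close> once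
      the form of \<open>L\<close> is replaced by \<open>K\<close> times the squared norm.\<close>
    have "u \<bullet> ((1 / K) *\<^sub>R u) - 1 / 2 * (K * (norm ((1 / K) *\<^sub>R u))\<^sup>2)
        \<le> u \<bullet> ((1 / K) *\<^sub>R u) - 1 / 2 * (((1 / K) *\<^sub>R u) \<bullet> (L *v ((1 / K) *\<^sub>R u)))"
      using quad[of "(1 / K) *\<^sub>R u"] by linarith
    also have "\<dots> \<le> bregman f x y"
      unfolding u_def by (rule bregman_lower[OF sc sm])
    also have "\<dots> \<le> 1 / 2 * mat_norm_sq L (x - y)"
      using sm unfolding matrix_smooth_def by blast
    also have "\<dots> \<le> 1 / 2 * (K * (norm (x - y))\<^sup>2)"
      using quad[of "x - y"] by (simp add: mat_norm_sq_def)
    also have "u \<bullet> ((1 / K) *\<^sub>R u) - 1 / 2 * (K * (norm ((1 / K) *\<^sub>R u))\<^sup>2) = (norm u)\<^sup>2 / (2 * K)"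
      using K by (simp add: field_simps power2_eq_square flip: power2_norm_eq_inner)
    finally have "(norm u)\<^sup>2 \<le> (K * norm (x - y))\<^sup>2"
      using K by (simp add: field_simps power2_eq_square)
    then show ?thesis
      unfolding u_def[symmetric] by (rule power2_le_imp_le) (use K in simp)
  qed
  then have "K-lipschitz_on UNIV (grad f)"
    using K by (intro lipschitz_onI) (auto simp: dist_norm)
  then show ?thesis by (rule lipschitz_on_continuous_on)
qed

text \<open>Take w = \<gamma> B u in \<open>bregman_lower\<close>: the linear term is
  \<open>\<gamma> * q\<close>, and the stepsize condition bounds the quadratic form by the same
  number, half of which is subtracted.\<close>

lemma bregman_lower_stepsize:
  assumes sc: "strongly_convex \<mu> f" "0 \<le> \<mu>" and sm: "matrix_smooth L f"
    and L: "pos_def L" and B: "pos_def B"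
    and \<gamma>: "0 < \<gamma>" "\<gamma> \<le> inverse (lambda_max (L ** B))"
  shows "\<gamma> * ((grad f x - grad f y) \<bullet> (B *v (grad f x - grad f y))) \<le> 2 * bregman f x y"
proof -
  define u where "u = grad f x - grad f y"
  define q where "q = u \<bullet> (B *v u)"
  have q: "0 \<le> q" using B by (cases "u = 0") (auto simp: pos_def_def q_def less_imp_le)
  \<comment> \<open>The inverse of a nonpositive real is nonpositive (that of 0 is 0), so the
    stepsize bounds alone force positivity.\<close>
  have "0 < lambda_max (L ** B)" using \<gamma> by (metis inverse_positive_iff_positive less_le_trans)
  then have \<gamma>1: "\<gamma> * lambda_max (L ** B) \<le> 1" using \<gamma> by (simp add: field_simps)
  have "(\<gamma> *\<^sub>R (B *v u)) \<bullet> (L *v (\<gamma> *\<^sub>R (B *v u))) = \<gamma> * \<gamma> * ((B *v u) \<bullet> (L *v (B *v u)))"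
    by (simp add: matrix_vector_mult_scaleR)
  also have "\<dots> \<le> \<gamma> * \<gamma> * (lambda_max (L ** B) * q)"
    unfolding q_def by (intro mult_left_mono lambda_max_product_bound L B) simp
  also have "\<dots> = (\<gamma> * lambda_max (L ** B)) * (\<gamma> * q)" by simp
  also have "\<dots> \<le> \<gamma> * q" using mult_right_mono[OF \<gamma>1, of "\<gamma> * q"] \<gamma> q by simp
  finally have "(\<gamma> *\<^sub>R (B *v u)) \<bullet> (L *v (\<gamma> *\<^sub>R (B *v u))) \<le> \<gamma> * q" .
  moreover have "u \<bullet> (\<gamma> *\<^sub>R (B *v u)) - 1 / 2 * ((\<gamma> *\<^sub>R (B *v u)) \<bullet> (L *v (\<gamma> *\<^sub>R (B *v u)))) \<le> bregman f x y"
    unfolding u_def by (rule bregman_lower[OF sc sm])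
  moreover have "u \<bullet> (\<gamma> *\<^sub>R (B *v u)) = \<gamma> * q" by (simp add: q_def)
  ultimately have "\<gamma> * q \<le> 2 * bregman f x y" by linarith
  then show ?thesis by (simp add: q_def u_def)
qed

section \<open>Composite minimizers and proximal points\<close>

text \<open>A hyperplane separates the point one unit below the graph at \<open>x0\<close> from the
  epigraph; solved for its last coordinate, it is the minorant.\<close>

lemma proper_closed_convex_affine_minorant:
  fixes g :: "'a::euclidean_space \<Rightarrow> ereal"
  assumes "proper_closed_convex g"
  obtains v c where "\<And>x. ereal (v \<bullet> x + c) \<le> g x"
proof -
  obtain x0 where x0: "g x0 \<noteq> \<infinity>" "g x0 \<noteq> -\<infinity>"
    using assms by (auto simp: proper_closed_convex_def)
  then obtain r0 where r0: "g x0 = ereal r0" by (cases "g x0") auto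
  have "(x0, r0 - 1) \<notin> ereal_epigraph g" by (simp add: ereal_epigraph_def r0)
  then obtain p b where below: "p \<bullet> (x0, r0 - 1) < b"
    and above: "\<And>z. z \<in> ereal_epigraph g \<Longrightarrow> b < p \<bullet> z"
    using separating_hyperplane_closed_point assms unfolding proper_closed_convex_def by metis
  obtain a s where p: "p = (a, s)" by (cases p)
  have epi: "b < a \<bullet> x + s * r" if "g x \<le> ereal r" for x r
    using above[of "(x, r)"] that by (simp add: ereal_epigraph_def p)
  \<comment> \<open>The hyperplane is not vertical: \<open>(x0, r0)\<close> and
    \<open>(x0, r0 - 1)\<close> lie strictly on different sides.\<close>
  have "0 < s" using epi[of x0 r0] below by (simp add: r0 p algebra_simps)
  have "ereal ((- (1 / s) *\<^sub>R a) \<bullet> x + b / s) \<le> g x" for x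
  proof (cases "g x")
    case (real r)
    then have "b < a \<bullet> x + s * r" using epi by simp
    then have "- (a \<bullet> x) / s + b / s < r" using \<open>0 < s\<close> by (simp add: field_simps)
    then show ?thesis by (simp add: real)
  next
    case MInf
    then show ?thesis using assms by (simp add: proper_closed_convex_def)
  qed simp
  then show ?thesis using that by blast
qed

text \<open>\<open>arg_min\<close> is a choice, so existence gives meaning to both
  \<open>composite_minimizer\<close> and \<open>prox\<close>. Strong convexity of \<open>f\<close>
  outgrows the affine minorant of \<open>g\<close>. As \<open>g\<close> is only lower
  semicontinuous, the minimum is taken of the continuous height \<open>snd\<close> over a compact
  piece of the epigraph of f + g.\<close>

lemma composite_minimizer_exists:
  fixes f :: "'a::euclidean_space \<Rightarrow> real"
  assumes cont: "continuous_on UNIV f" and sc: "strongly_convex \<mu> f" and \<mu>: "0 < \<mu>"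
    and g: "proper_closed_convex g"
  shows "\<exists>x. is_arg_min (\<lambda>x. ereal (f x) + g x) (\<lambda>_. True) x"
proof -
  obtain x0 where x0: "g x0 \<noteq> \<infinity>" "g x0 \<noteq> -\<infinity>"
    using g by (auto simp: proper_closed_convex_def)
  then obtain r0 where r0: "g x0 = ereal r0" by (cases "g x0") auto
  obtain v c where minor: "\<And>x. ereal (v \<bullet> x + c) \<le> g x"
    using proper_closed_convex_affine_minorant[OF g] by blast
  define w where "w = v + grad f 0"
  define k where "k = c + f 0"
  define V where "V = f x0 + r0"
  \<comment> \<open>The part of the epigraph of f + g at or below the value \<open>V\<close>
    attained at \<open>x0\<close>.\<close>
  define E where "E = {z. (fst z, snd z - f (fst z)) \<in> ereal_epigraph g \<and> snd z \<le> V}"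
  have lower: "\<mu> / 2 * (norm x)\<^sup>2 - norm w * norm x + k \<le> s" if "g x \<le> ereal (s - f x)" for x s
  proof -
    have "\<mu> / 2 * (norm (x - 0))\<^sup>2 \<le> bregman f x 0"
      using sc unfolding strongly_convex_def by blast
    moreover have "v \<bullet> x + c \<le> s - f x"
      using order_trans[OF minor that] by simp
    moreover have "- (norm w * norm x) \<le> w \<bullet> x"
      using norm_cauchy_schwarz[of "- w" x] by simp
    ultimately show ?thesis
      by (simp add: bregman_def w_def k_def inner_add_left)
  qed
  have "closed ((\<lambda>z. (fst z, snd z - f (fst z))) -` ereal_epigraph g \<inter> {z. snd z \<le> V})"
  proof (intro closed_Int closed_vimage)
    show "closed (ereal_epigraph g)" using g by (simp add: proper_closed_convex_def)
    show "continuous_on UNIV (\<lambda>z. (fst z, snd z - f (fst z)))"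
      by (intro continuous_intros continuous_on_compose2[OF cont]) auto
    show "closed {z::'a \<times> real. snd z \<le> V}"
      by (intro closed_Collect_le continuous_intros)
  qed
  then have closed: "closed E" by (simp add: E_def vimage_def Int_def)
  have "bounded E"
  proof -
    \<comment> \<open>The larger root in n of
      \<open>\<mu> * n\<^sup>2 - 2 * norm w * n - 2 * \<bar>V - k\<bar>\<close>, with n in the place
      of \<open>norm x\<close>.\<close>
    define \<rho> where "\<rho> = (norm w + sqrt ((norm w)\<^sup>2 + 2 * \<mu> * \<bar>V - k\<bar>)) / \<mu>"
    have "norm x \<le> \<rho> \<and> k - norm w * \<rho> \<le> s \<and> s \<le> V" if "(x, s) \<in> E" for x s
    proof -
      have s: "\<mu> / 2 * (norm x)\<^sup>2 - norm w * norm x + k \<le> s" "s \<le> V"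
        using that lower by (auto simp: E_def ereal_epigraph_def)
      then have "\<mu> * (norm x)\<^sup>2 \<le> 2 * (norm w * norm x) + 2 * \<bar>V - k\<bar>" by argo
      then have "\<mu> * (\<mu> * (norm x)\<^sup>2) \<le> \<mu> * (2 * (norm w * norm x) + 2 * \<bar>V - k\<bar>)"
        using \<mu> by (intro mult_left_mono) auto
      then have "(\<mu> * norm x - norm w)\<^sup>2 \<le> (norm w)\<^sup>2 + 2 * \<mu> * \<bar>V - k\<bar>"
        by (simp add: power2_eq_square algebra_simps)
      then have "\<mu> * norm x - norm w \<le> sqrt ((norm w)\<^sup>2 + 2 * \<mu> * \<bar>V - k\<bar>)"
        by (rule real_le_rsqrt)
      then have \<rho>: "norm x \<le> \<rho>" using \<mu> by (simp add: \<rho>_def field_simps)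
      have "norm w * norm x \<le> norm w * \<rho>" using \<rho> by (rule mult_left_mono) simp
      moreover have "0 \<le> \<mu> / 2 * (norm x)\<^sup>2" using \<mu> by simp
      ultimately show ?thesis using s \<rho> by linarith
    qed
    then have "E \<subseteq> cball 0 \<rho> \<times> {k - norm w * \<rho>..V}" by auto
    then show ?thesis by (metis bounded_subset bounded_Times bounded_cball bounded_closed_interval)
  qed
  with closed have "compact E" by (simp add: compact_eq_bounded_closed)
  moreover have "(x0, V) \<in> E" by (simp add: E_def ereal_epigraph_def V_def r0)
  ultimately obtain z where z: "z \<in> E" and min: "\<And>y. y \<in> E \<Longrightarrow> snd z \<le> snd y"
    using continuous_attains_inf[of E snd] continuous_on_snd[OF continuous_on_id] by blast
  have "is_arg_min (\<lambda>x. ereal (f x) + g x) (\<lambda>_. True) (fst z)"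
    unfolding is_arg_min_linorder
  proof (intro conjI TrueI allI impI)
    fix y
    have "ereal (f (fst z)) + g (fst z) \<le> ereal (snd z)"
      using z by (cases "g (fst z)") (auto simp: E_def ereal_epigraph_def)
    also have "ereal (snd z) \<le> ereal (f y) + g y"
    proof (cases "g y")
      case (real r)
      show ?thesis
      proof (cases "f y + r \<le> V")
        case True
        then have "(y, f y + r) \<in> E" by (simp add: E_def ereal_epigraph_def real)
        then show ?thesis using min real by fastforce
      next
        case False
        then show ?thesis using z by (simp add: E_def real)
      qed
    next
      case MInf
      then show ?thesis using g by (simp add: proper_closed_convex_def)
    qed simp
    finally show "ereal (f (fst z)) + g (fst z) \<le> ereal (f y) + g y" .
  qed
  then show ?thesis by blast
qed

text \<open>Compare the minimizer with \<open>x + t *\<^sub>R (y - x)\<close>, bound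
  \<open>g\<close> there by convexity, divide by \<open>t\<close> and let \<open>t\<close> decrease
  to 0. The result says that \<open>- D\<close> is a subgradient of \<open>g\<close> at
  \<open>x\<close>.\<close>

lemma composite_minimizer_variational:
  fixes f :: "'a::euclidean_space \<Rightarrow> real"
  assumes g: "proper_closed_convex g" and f: "GDERIV f x :> D"
    and min: "is_arg_min (\<lambda>x. ereal (f x) + g x) (\<lambda>_. True) x"
  shows "g x \<noteq> \<infinity>" and "g x \<le> g y + ereal (D \<bullet> (y - x))"
proof -
  have le: "ereal (f x) + g x \<le> ereal (f y) + g y" for y
    using min by (simp add: is_arg_min_linorder)
  have gm: "g y \<noteq> -\<infinity>" for y using g by (simp add: proper_closed_convex_def)
  obtain y0 where "g y0 \<noteq> \<infinity>" using g by (auto simp: proper_closed_convex_def)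
  then show fin: "g x \<noteq> \<infinity>" using le[of y0] gm[of y0] by (cases "g y0") auto
  then obtain a where a: "g x = ereal a" using gm[of x] by (cases "g x") auto
  show "g x \<le> g y + ereal (D \<bullet> (y - x))"
  proof (cases "g y")
    case (real b)
    have "((\<lambda>t. x + t *\<^sub>R (y - x)) has_derivative (\<lambda>t. t *\<^sub>R (y - x))) (at 0)"
      by (auto intro!: derivative_eq_intros)
    moreover have "(f has_derivative (\<lambda>h. h \<bullet> D)) (at (x + 0 *\<^sub>R (y - x)))"
      using f by (simp add: gderiv_def)
    ultimately have "((\<lambda>t. f (x + t *\<^sub>R (y - x))) has_derivative (\<lambda>t. (t *\<^sub>R (y - x)) \<bullet> D)) (at 0)"
      using has_derivative_compose by blast
    then have "((\<lambda>t. f (x + t *\<^sub>R (y - x))) has_real_derivative (D \<bullet> (y - x))) (at 0)"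
      by (simp add: has_field_derivative_def inner_commute mult_commute_abs)
    then have "(\<lambda>t. (f (x + t *\<^sub>R (y - x)) - f x) / t) \<midarrow>0\<rightarrow> D \<bullet> (y - x)"
      by (simp add: DERIV_def)
    then have lim: "((\<lambda>t. (f (x + t *\<^sub>R (y - x)) - f x) / t) \<longlongrightarrow> D \<bullet> (y - x)) (at_right 0)"
      by (rule filterlim_mono) (auto simp: at_within_le_at)
    have "a - b \<le> D \<bullet> (y - x)"
    proof (rule tendsto_lowerbound[OF lim])
      have "a - b \<le> (f (x + t *\<^sub>R (y - x)) - f x) / t" if "0 < t" "t < 1" for t
      proof -
        have "(1 - t) *\<^sub>R (x, a) + t *\<^sub>R (y, b) \<in> ereal_epigraph g"
          using g that by (intro convexD) (auto simp: proper_closed_convex_def ereal_epigraph_def a real)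
        then have "g (x + t *\<^sub>R (y - x)) \<le> ereal ((1 - t) * a + t * b)"
          by (simp add: ereal_epigraph_def algebra_simps)
        then have "ereal (f x + a) \<le> ereal (f (x + t *\<^sub>R (y - x)) + ((1 - t) * a + t * b))"
          using le[of "x + t *\<^sub>R (y - x)"] a by (cases "g (x + t *\<^sub>R (y - x))") auto
        then have "t * (a - b) \<le> f (x + t *\<^sub>R (y - x)) - f x"
          by (simp add: algebra_simps)
        then show ?thesis using that by (simp add: field_simps)
      qed
      then show "\<forall>\<^sub>F t in at_right 0. a - b \<le> (f (x + t *\<^sub>R (y - x)) - f x) / t"
        unfolding eventually_at_right_field by (intro exI[of _ 1]) auto
    qed simp
    then show ?thesis by (simp add: a real)
  next
    case MInf
    then show ?thesis using gm by simp
  qed simp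
qed

section \<open>Proximal points as composite minimizers\<close>

lemma GDERIV_half_norm_sq: "GDERIV (\<lambda>u. 1 / 2 * (norm (u - x))\<^sup>2) y :> y - x"
proof -
  have "((\<lambda>u. 1 / 2 * ((u - x) \<bullet> (u - x))) has_derivative (\<lambda>h. 1 / 2 * ((y - x) \<bullet> h + h \<bullet> (y - x)))) (at y)"
    by (auto intro!: derivative_eq_intros)
  then show ?thesis
    by (simp add: gderiv_def power2_norm_eq_inner inner_commute)
qed

text \<open>The proximal objective is composite, with half the squared distance to \<open>x\<close>
  as its 1-strongly convex smooth part; the summands are swapped to match that form.\<close>

lemma prox_is_arg_min:
  assumes "proper_closed_convex g"
  shows "is_arg_min (\<lambda>u. ereal (1 / 2 * (norm (u - x))\<^sup>2) + g u) (\<lambda>_. True) (prox g x)"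
proof -
  have "bregman (\<lambda>u. 1 / 2 * (norm (u - x))\<^sup>2) y z = 1 / 2 * (norm (y - z))\<^sup>2" for y z
    by (simp only: bregman_def grad_eqI[OF GDERIV_half_norm_sq])
      (simp add: power2_norm_eq_inner inner_diff_left inner_diff_right inner_commute field_simps)
  then have "strongly_convex 1 (\<lambda>u. 1 / 2 * (norm (u - x))\<^sup>2)" by (simp add: strongly_convex_def)
  then have "\<exists>u. is_arg_min (\<lambda>u. ereal (1 / 2 * (norm (u - x))\<^sup>2) + g u) (\<lambda>_. True) u"
    using assms by (intro composite_minimizer_exists[where \<mu> = 1] continuous_intros) auto
  then show ?thesis
    unfolding prox_def arg_min_def add.commute[of "g _"] by (rule someI_ex)
qed

lemma
  assumes "proper_closed_convex g"
  shows prox_finite: "g (prox g x) \<noteq> \<infinity>"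
    and prox_variational: "g (prox g x) \<le> g y + ereal ((prox g x - x) \<bullet> (y - prox g x))"
  using composite_minimizer_variational[OF assms GDERIV_half_norm_sq prox_is_arg_min[OF assms]]
  by auto

text \<open>Test the variational inequality of each proximal point at the other one and add; the
  values of \<open>g\<close> are finite and cancel. The continuity of \<open>prox\<close> rests on
  this.\<close>

lemma prox_firmly_nonexpansive:
  assumes "proper_closed_convex g"
  shows "(norm (prox g x - prox g y))\<^sup>2 \<le> (prox g x - prox g y) \<bullet> (x - y)"
proof -
  obtain a where a: "g (prox g x) = ereal a"
    using prox_finite[OF assms, of x] assms by (cases "g (prox g x)") (auto simp: proper_closed_convex_def)
  obtain b where b: "g (prox g y) = ereal b"
    using prox_finite[OF assms, of y] assms by (cases "g (prox g y)") (auto simp: proper_closed_convex_def)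
  have "a \<le> b + (prox g x - x) \<bullet> (prox g y - prox g x)"
    using prox_variational[OF assms, of x "prox g y"] by (simp add: a b)
  moreover have "b \<le> a + (prox g y - y) \<bullet> (prox g x - prox g y)"
    using prox_variational[OF assms, of y "prox g x"] by (simp add: a b)
  ultimately show ?thesis
    by (simp add: power2_norm_eq_inner inner_diff_left inner_diff_right inner_commute)
qed

lemma continuous_on_prox:
  assumes "proper_closed_convex g"
  shows "continuous_on UNIV (prox g)"
proof -
  have "norm (prox g x - prox g y) \<le> 1 * norm (x - y)" for x y
  proof -
    have "(norm (prox g x - prox g y))\<^sup>2 \<le> norm (prox g x - prox g y) * norm (x - y)"
      using prox_firmly_nonexpansive[OF assms] norm_cauchy_schwarz order_trans by blast
    then show ?thesis
      by (cases "norm (prox g x - prox g y) = 0") (simp_all add: power2_eq_square)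
  qed
  then have "1-lipschitz_on UNIV (prox g)"
    by (intro lipschitz_onI) (auto simp: dist_norm)
  then show ?thesis by (rule lipschitz_on_continuous_on)
qed

text \<open>The epigraph of the multiple is the preimage of that of \<open>g\<close> under a
  continuous linear map, division of the last coordinate by \<open>\<eta>\<close>.\<close>

lemma proper_closed_convex_scale:
  assumes g: "proper_closed_convex g" and "0 < \<eta>"
  shows "proper_closed_convex (\<lambda>x. ereal \<eta> * g x)"
proof -
  have "ereal \<eta> * g x \<le> ereal r \<longleftrightarrow> g x \<le> ereal (r / \<eta>)" for x r
    using \<open>0 < \<eta>\<close> by (cases "g x") (auto simp: field_simps)
  then have epi: "ereal_epigraph (\<lambda>x. ereal \<eta> * g x) = (\<lambda>z. (fst z, snd z / \<eta>)) -` ereal_epigraph g"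
    by (auto simp: ereal_epigraph_def)
  have "closed (ereal_epigraph (\<lambda>x. ereal \<eta> * g x))"
    unfolding epi using g \<open>0 < \<eta>\<close>
    by (intro closed_vimage) (auto simp: proper_closed_convex_def intro!: continuous_intros)
  moreover have "convex (ereal_epigraph (\<lambda>x. ereal \<eta> * g x))"
    unfolding epi using g
    by (intro convex_linear_vimage) (auto simp: proper_closed_convex_def add_divide_distrib intro!: linearI)
  moreover have "ereal \<eta> * g x \<noteq> -\<infinity>" for x
    using g \<open>0 < \<eta>\<close> by (cases "g x") (auto simp: proper_closed_convex_def)
  moreover obtain x where "g x \<noteq> \<infinity>" "g x \<noteq> -\<infinity>" using g by (auto simp: proper_closed_convex_def)
  then have "ereal \<eta> * g x \<noteq> \<infinity>" by (cases "g x") auto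
  ultimately show ?thesis unfolding proper_closed_convex_def by blast
qed

text \<open>Optimality of the composite minimizer \<open>x\<^sub>\<star>\<close> means \<open>x\<^sub>\<star> = prox (x\<^sub>\<star> - \<eta>\<nabla>f(x\<^sub>\<star>))\<close>; this is firm
  nonexpansiveness against that fixed point.\<close>

lemma prox_composite_minimizer:
  fixes f :: "'a::euclidean_space \<Rightarrow> real" and \<psi> :: "'a \<Rightarrow> ereal" and z :: 'a
  assumes diff: "\<And>x. f differentiable (at x)" and sc: "strongly_convex \<mu> f" "0 < \<mu>"
    and \<psi>: "proper_closed_convex \<psi>" and \<eta>: "0 < \<eta>"
  defines "xs \<equiv> composite_minimizer f \<psi>"
    and "p \<equiv> prox (\<lambda>u. ereal \<eta> * \<psi> u) z"
  shows "0 \<le> (p - xs) \<bullet> (z + \<eta> *\<^sub>R grad f xs - p)"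
proof -
  have "continuous_on UNIV f"
    by (intro differentiable_imp_continuous_on differentiable_at_imp_differentiable_on diff)
  then have "\<exists>x. is_arg_min (\<lambda>x. ereal (f x) + \<psi> x) (\<lambda>_. True) x"
    using sc \<psi> by (rule composite_minimizer_exists)
  then have "is_arg_min (\<lambda>x. ereal (f x) + \<psi> x) (\<lambda>_. True) xs"
    unfolding xs_def composite_minimizer_def arg_min_def by (rule someI_ex)
  note var = composite_minimizer_variational[OF \<psi> GDERIV_grad[OF diff] this]
  obtain a where a: "\<psi> xs = ereal a"
    using var(1) \<psi> by (cases "\<psi> xs") (auto simp: proper_closed_convex_def)
  note pcc = proper_closed_convex_scale[OF \<psi> \<eta>]
  obtain b where b: "\<psi> p = ereal b"
    using prox_finite[OF pcc, of z] \<psi> \<eta>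
    by (cases "\<psi> p") (auto simp: proper_closed_convex_def p_def)
  \<comment> \<open>Optimality of \<open>xs\<close> is tested at \<open>p\<close>, then that of
    \<open>p\<close> at \<open>xs\<close>. After scaling the first by \<open>\<eta>\<close>, the
    values of \<open>\<psi>\<close> cancel in the sum.\<close>
  have "a \<le> b + grad f xs \<bullet> (p - xs)"
    using var(2)[of p] by (simp add: a b)
  then have "\<eta> * a \<le> \<eta> * (b + grad f xs \<bullet> (p - xs))"
    using \<eta> by (intro mult_left_mono) auto
  moreover have "\<eta> * b \<le> \<eta> * a + (p - z) \<bullet> (xs - p)"
    using prox_variational[OF pcc, of z xs] by (simp add: a b flip: p_def)
  ultimately show ?thesis
    by (simp add: inner_diff_left inner_diff_right inner_add_right inner_commute algebra_simps)
qed

section \<open>One iteration in expectation\<close>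

text \<open>The factor 1 / (1 + \<omega>) makes the two second moments add up to at most
  \<open>2 / (1 + \<omega>) * (norm q)\<^sup>2\<close>, which merges with the cross term. The
  nonnegative integral fits the later use of Tonelli.\<close>

lemma scalar_compressor_step:
  assumes C: "scalar_compressor \<omega> R C" and \<omega>: "0 \<le> \<omega>"
  shows "(\<integral>\<^sup>+r. ennreal ((norm (a - (1 / (1 + \<omega>)) *\<^sub>R C r q))\<^sup>2 + (norm (b - (1 / (1 + \<omega>)) *\<^sub>R C r q))\<^sup>2) \<partial>R)
    \<le> ennreal ((norm a)\<^sup>2 + (norm b)\<^sup>2 - 2 / (1 + \<omega>) * (q \<bullet> (a + b - q)))"
proof -
  interpret R: prob_space R using C by (simp add: scalar_compressor_def random_operator_def)
  define k where "k = 1 / (1 + \<omega>)"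
  have k: "0 < k" "k * (1 + \<omega>) = 1" using \<omega> by (simp_all add: k_def)
  have mean: "has_bochner_integral R (\<lambda>r. C r q) q"
    using C by (simp add: scalar_compressor_def unbiased_def)
  have int_sq: "integrable R (\<lambda>r. (norm (C r q))\<^sup>2)" and sq: "(\<integral>r. (norm (C r q))\<^sup>2 \<partial>R) \<le> (1 + \<omega>) * (norm q)\<^sup>2"
    using C by (auto simp: scalar_compressor_def)
  have int_C: "integrable R (\<lambda>r. C r q)" using mean by (rule integrable.intros)
  have E_C: "(\<integral>r. C r q \<partial>R) = q" using mean by (rule has_bochner_integral_integral_eq)
  let ?F = "\<lambda>r. ((norm a)\<^sup>2 + (norm b)\<^sup>2) - (2 * k) * ((a + b) \<bullet> C r q) + (2 * k\<^sup>2) * (norm (C r q))\<^sup>2"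
  have expand: "(norm (a - k *\<^sub>R C r q))\<^sup>2 + (norm (b - k *\<^sub>R C r q))\<^sup>2 = ?F r" for r
    by (simp only: power2_norm_eq_inner)
      (simp add: inner_diff_left inner_diff_right inner_add_left inner_commute power2_eq_square algebra_simps)
  have int1: "integrable R (\<lambda>r. (2 * k) * ((a + b) \<bullet> C r q))"
    and int2: "integrable R (\<lambda>r. (2 * k\<^sup>2) * (norm (C r q))\<^sup>2)"
    using int_C int_sq by auto
  have int: "integrable R ?F"
    by (intro Bochner_Integration.integrable_add Bochner_Integration.integrable_diff
        R.integrable_const int1 int2)
  have "(\<integral>r. ?F r \<partial>R) = ((norm a)\<^sup>2 + (norm b)\<^sup>2) - (2 * k) * ((a + b) \<bullet> q) + (2 * k\<^sup>2) * (\<integral>r. (norm (C r q))\<^sup>2 \<partial>R)"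
    using int1 int2 int_C by (simp add: R.prob_space E_C)
  also have "(2 * k\<^sup>2) * (\<integral>r. (norm (C r q))\<^sup>2 \<partial>R) \<le> (2 * k\<^sup>2) * ((1 + \<omega>) * (norm q)\<^sup>2)"
    using sq by (intro mult_left_mono) auto
  also have "\<dots> = 2 * k * (k * (1 + \<omega>)) * (norm q)\<^sup>2" by (simp add: power2_eq_square)
  also have "\<dots> = 2 * k * (norm q)\<^sup>2" using k by simp
  finally have le: "(\<integral>r. ?F r \<partial>R) \<le> (norm a)\<^sup>2 + (norm b)\<^sup>2 - 2 * k * (q \<bullet> (a + b - q))"
    by (simp add: power2_norm_eq_inner inner_diff_right inner_add_right inner_commute algebra_simps)
  have "(\<integral>\<^sup>+r. ennreal (?F r) \<partial>R) = ennreal (\<integral>r. ?F r \<partial>R)"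
    by (intro nn_integral_eq_integral int) (simp flip: expand)
  also have "\<dots> \<le> ennreal ((norm a)\<^sup>2 + (norm b)\<^sup>2 - 2 * k * (q \<bullet> (a + b - q)))"
    using le by (rule ennreal_leI)
  finally show ?thesis unfolding k_def[symmetric] expand by (simp add: k_def)
qed

text \<open>In the expanded square, unbiasedness evaluates the cross term and the compressor class
  bounds the second moment by \<open>(u - v) \<bullet> (W *v (u - v))\<close>. The mixed terms in
  \<open>u\<close> and \<open>v\<close> cancel by symmetry of \<open>W\<close>.\<close>

lemma matrix_compressor_step:
  fixes \<Omega> :: "real^'n^'n"
  assumes C: "matrix_compressor \<Omega> S C" and \<Omega>: "pos_semidef \<Omega>"
  defines "W \<equiv> matrix_inv (mat 1 + \<Omega>)"
  shows "integrable S (\<lambda>s. (norm (u - W *v C s (u - v)))\<^sup>2)"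
    and "(\<integral>s. (norm (u - W *v C s (u - v)))\<^sup>2 \<partial>S) \<le> u \<bullet> u - u \<bullet> (W *v u) + v \<bullet> (W *v v)"
proof -
  interpret S: prob_space S using C by (simp add: matrix_compressor_def random_operator_def)
  note sym = symmetric_matrix_inner[OF resolvent_symmetric[OF \<Omega>], folded W_def]
  have mean: "has_bochner_integral S (\<lambda>s. C s (u - v)) (u - v)"
    using C by (simp add: matrix_compressor_def unbiased_def)
  have int_C: "integrable S (\<lambda>s. C s (u - v))" using mean by (rule integrable.intros)
  have E_C: "(\<integral>s. C s (u - v) \<partial>S) = u - v" using mean by (rule has_bochner_integral_integral_eq)
  have int_sq: "integrable S (\<lambda>s. (norm (W *v C s (u - v)))\<^sup>2)"
    and sq: "(\<integral>s. (norm (W *v C s (u - v)))\<^sup>2 \<partial>S) \<le> (u - v) \<bullet> (W *v (u - v))"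
    using C by (auto simp: matrix_compressor_def mat_norm_sq_def W_def)
  let ?F = "\<lambda>s. u \<bullet> u - 2 * ((W *v u) \<bullet> C s (u - v)) + (norm (W *v C s (u - v)))\<^sup>2"
  have expand: "(norm (u - W *v C s (u - v)))\<^sup>2 = ?F s" for s
    unfolding sym
    by (simp add: power2_norm_eq_inner inner_diff_left inner_diff_right inner_commute)
  have int1: "integrable S (\<lambda>s. 2 * ((W *v u) \<bullet> C s (u - v)))" using int_C by auto
  show "integrable S (\<lambda>s. (norm (u - W *v C s (u - v)))\<^sup>2)"
    unfolding expand
    by (intro Bochner_Integration.integrable_add Bochner_Integration.integrable_diff
        S.integrable_const int1 int_sq)
  have "(\<integral>s. ?F s \<partial>S) = u \<bullet> u - 2 * ((W *v u) \<bullet> (u - v)) + (\<integral>s. (norm (W *v C s (u - v)))\<^sup>2 \<partial>S)"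
    using int1 int_sq int_C by (simp add: S.prob_space E_C)
  also have "\<dots> \<le> u \<bullet> u - 2 * ((W *v u) \<bullet> (u - v)) + (u - v) \<bullet> (W *v (u - v))"
    using sq by simp
  also have "\<dots> = u \<bullet> u - u \<bullet> (W *v u) + v \<bullet> (W *v v)"
    using sym[of u v]
    by (simp add: matrix_vector_mult_diff_distrib inner_diff_left inner_diff_right inner_commute)
  finally show "(\<integral>s. (norm (u - W *v C s (u - v)))\<^sup>2 \<partial>S) \<le> u \<bullet> u - u \<bullet> (W *v u) + v \<bullet> (W *v v)"
    by (simp only: expand)
qed

text \<open>The seed sequences enter only later: the analysis of one step depends on the laws
  \<open>R\<close> and \<open>S\<close> alone.\<close>

locale gradskip =
  fixes f :: "real^'n \<Rightarrow> real" and \<psi> :: "real^'n \<Rightarrow> ereal"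
    and L \<Omega> :: "real^'n^'n" and \<mu> \<omega> \<gamma> :: real
    and R :: "'r measure" and C\<omega> :: "'r \<Rightarrow> real^'n \<Rightarrow> real^'n"
    and S :: "'s measure" and C\<Omega> :: "'s \<Rightarrow> real^'n \<Rightarrow> real^'n"
  assumes diff: "f differentiable (at x)"
    and \<mu>: "\<mu> > 0" and sc: "strongly_convex \<mu> f"
    and L: "pos_def L" and smooth: "matrix_smooth L f"
    and \<psi>: "proper_closed_convex \<psi>"
    and \<omega>: "\<omega> \<ge> 0" and \<Omega>: "pos_semidef \<Omega>"
    and C\<omega>: "scalar_compressor \<omega> R C\<omega>" and C\<Omega>: "matrix_compressor \<Omega> S C\<Omega>"
    and \<gamma>: "0 < \<gamma>" "\<gamma> \<le> inverse (lambda_max (L ** Omega_tilde \<omega> \<Omega>))"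
begin

sublocale R: prob_space R using C\<omega> by (simp add: scalar_compressor_def random_operator_def)
sublocale S: prob_space S using C\<Omega> by (simp add: matrix_compressor_def random_operator_def)
sublocale RS: pair_prob_space R S ..

abbreviation "W \<equiv> matrix_inv (mat 1 + \<Omega>)"
abbreviation "xs \<equiv> composite_minimizer f \<psi>"
abbreviation "hs \<equiv> grad f xs"
abbreviation "\<Phi> \<equiv> lyapunov f \<psi> \<gamma> \<omega>"
abbreviation "step z \<equiv> gradskip_step f \<psi> \<gamma> \<omega> \<Omega> (C\<omega> (fst z)) (C\<Omega> (snd z))"

definition "\<delta> = 1 - 1 / (1 + lambda_min \<Omega>) * (1 - 1 / (1 + \<omega>)\<^sup>2)"
text \<open>The larger of 1 - \<gamma>\<mu>, which contracts the error in x, and 1 - \<delta>, which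
  contracts the error in h.\<close>

definition "\<rho> = 1 - min (\<gamma> * \<mu>) \<delta>"

lemma \<delta>_bounds: "0 \<le> \<delta>" "\<delta> \<le> 1"
proof -
  have "0 \<le> 1 / (1 + lambda_min \<Omega>)" "1 / (1 + lambda_min \<Omega>) \<le> 1"
    using lambda_min_psd(1)[OF \<Omega>] by simp_all
  moreover have "1 \<le> (1 + \<omega>)\<^sup>2" using \<omega> by (simp add: one_le_power)
  then have "0 \<le> 1 - 1 / (1 + \<omega>)\<^sup>2" "1 - 1 / (1 + \<omega>)\<^sup>2 \<le> 1"
    by (auto simp: divide_le_eq_1)
  ultimately show "0 \<le> \<delta>" "\<delta> \<le> 1"
    unfolding \<delta>_def using mult_le_one mult_nonneg_nonneg by (metis diff_ge_0_iff_ge, simp)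
qed

lemma \<rho>_nonneg: "0 \<le> \<rho>"
  using \<delta>_bounds by (simp add: \<rho>_def min_def)

lemma lyapunov_nonneg: "0 \<le> \<Phi> y"
  by (cases y) (simp add: lyapunov_def)

lemma deterministic_contraction:
  fixes x h :: "real^'n"
  defines "u \<equiv> grad f x - hs" and "v \<equiv> h - hs"
  shows "(norm (x - xs - \<gamma> *\<^sub>R u))\<^sup>2 + \<gamma>\<^sup>2 * (\<omega> * (\<omega> + 2)) * (u \<bullet> u - u \<bullet> (W *v u) + v \<bullet> (W *v v))
    \<le> \<rho> * \<Phi> (x, h)"
proof -
  define k where "k = \<omega> * (\<omega> + 2)"
  have k: "0 \<le> k" using \<omega> by (simp add: k_def)
  define e where "e = x - xs"
  define B where "B = Omega_tilde \<omega> \<Omega>"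
  have B: "u \<bullet> (B *v u) = u \<bullet> u + k * (u \<bullet> u - u \<bullet> (W *v u))"
    by (simp add: B_def Omega_tilde_apply[OF \<Omega>] inner_add_right inner_diff_right k_def)
  have "\<gamma> * (u \<bullet> (B *v u)) \<le> 2 * bregman f x xs"
    unfolding u_def B_def
    using bregman_lower_stepsize[OF sc _ smooth L Omega_tilde_pos_def[OF \<Omega> \<omega>] \<gamma>] \<mu> by simp
  moreover have "\<mu> / 2 * (norm (xs - x))\<^sup>2 \<le> bregman f xs x"
    using sc unfolding strongly_convex_def by blast
  \<comment> \<open>The divergence is used in both directions: one absorbs the gradient term, the
    other supplies the \<mu> of strong convexity.\<close>
  moreover have "bregman f x xs + bregman f xs x = e \<bullet> u"
    by (simp add: bregman_def u_def e_def inner_diff_left inner_diff_right inner_commute)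
  ultimately have "\<gamma> * (u \<bullet> (B *v u)) - 2 * (e \<bullet> u) \<le> - \<mu> * (norm e)\<^sup>2"
    by (simp add: e_def norm_minus_commute)
  then have "\<gamma> * (\<gamma> * (u \<bullet> (B *v u)) - 2 * (e \<bullet> u)) \<le> \<gamma> * (- \<mu> * (norm e)\<^sup>2)"
    using \<gamma> by (intro mult_left_mono) auto
  then have x_part: "(norm e)\<^sup>2 - 2 * \<gamma> * (e \<bullet> u) + \<gamma>\<^sup>2 * (u \<bullet> (B *v u)) \<le> (1 - \<gamma> * \<mu>) * (norm e)\<^sup>2"
    by (simp add: power2_eq_square algebra_simps)
  have lm: "0 < 1 + lambda_min \<Omega>" using lambda_min_psd(1)[OF \<Omega>] by simp
  have "v \<bullet> (W *v v) \<le> 1 / (1 + lambda_min \<Omega>) * (v \<bullet> v)"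
    using resolvent_bounds(2)[OF \<Omega>, of v] lm by (simp add: field_simps)
  then have "k * (v \<bullet> (W *v v)) \<le> k * (1 / (1 + lambda_min \<Omega>) * (v \<bullet> v))"
    using k by (rule mult_left_mono)
  \<comment> \<open>The form of \<delta> comes from here:
    \<open>k = (1 + \<omega>)\<^sup>2 - 1\<close>, and dividing it by
    \<open>(1 + \<omega>)\<^sup>2 * (1 + lambda_min \<Omega>)\<close> gives 1 - \<delta>.\<close>
  also have "\<dots> = (1 - \<delta>) * ((1 + \<omega>)\<^sup>2 * (norm v)\<^sup>2)"
  proof -
    have "(1 + \<omega>)\<^sup>2 * (1 - 1 / (1 + \<omega>)\<^sup>2) = (1 + \<omega>)\<^sup>2 - 1"
      using \<omega> by (simp add: right_diff_distrib)
    also have "\<dots> = k" by (simp add: k_def power2_eq_square algebra_simps)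
    finally show ?thesis by (simp add: \<delta>_def power2_norm_eq_inner ac_simps)
  qed
  finally have "k * (v \<bullet> (W *v v)) \<le> (1 - \<delta>) * ((1 + \<omega>)\<^sup>2 * (norm v)\<^sup>2)" .
  then have h_part: "\<gamma>\<^sup>2 * (k * (v \<bullet> (W *v v))) \<le> (1 - \<delta>) * (\<gamma>\<^sup>2 * (1 + \<omega>)\<^sup>2 * (norm v)\<^sup>2)"
    using mult_left_mono[of _ _ "\<gamma>\<^sup>2"] by (fastforce simp: ac_simps)
  have "(norm (e - \<gamma> *\<^sub>R u))\<^sup>2 + \<gamma>\<^sup>2 * k * (u \<bullet> u - u \<bullet> (W *v u) + v \<bullet> (W *v v))
      = ((norm e)\<^sup>2 - 2 * \<gamma> * (e \<bullet> u) + \<gamma>\<^sup>2 * (u \<bullet> (B *v u))) + \<gamma>\<^sup>2 * (k * (v \<bullet> (W *v v)))"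
    unfolding B
    by (simp only: power2_norm_eq_inner)
      (simp add: inner_diff_left inner_diff_right inner_commute power2_eq_square algebra_simps)
  also have "\<dots> \<le> (1 - \<gamma> * \<mu>) * (norm e)\<^sup>2 + (1 - \<delta>) * (\<gamma>\<^sup>2 * (1 + \<omega>)\<^sup>2 * (norm v)\<^sup>2)"
    using x_part h_part by linarith
  also have "\<dots> \<le> \<rho> * (norm e)\<^sup>2 + \<rho> * (\<gamma>\<^sup>2 * (1 + \<omega>)\<^sup>2 * (norm v)\<^sup>2)"
    by (intro add_mono mult_right_mono) (auto simp: \<rho>_def)
  also have "\<dots> = \<rho> * \<Phi> (x, h)"
    by (simp add: lyapunov_def e_def v_def algebra_simps)
  finally show ?thesis by (simp only: e_def k_def)
qed

text \<open>The errors \<open>a = xh - xs\<close> and \<open>b = \<gamma>(1 + \<omega>)(hh - hs)\<close> receive the same noise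
  \<open>C\<omega> r q / (1 + \<omega>)\<close>, and \<open>q \<bullet> (a + b - q) \<ge> a \<bullet> b\<close> is the proximal inequality.\<close>

lemma prox_stage:
  fixes x h hh :: "real^'n"
  assumes hh: "hh = grad f x - W *v C\<Omega> s (grad f x - h)"
  shows "(\<integral>\<^sup>+r. ennreal (\<Phi> (step (r, s) (x, h))) \<partial>R)
    \<le> ennreal ((norm (x - xs - \<gamma> *\<^sub>R (grad f x - hs)))\<^sup>2 + \<gamma>\<^sup>2 * (\<omega> * (\<omega> + 2)) * (norm (hh - hs))\<^sup>2)"
proof -
  define \<eta> where "\<eta> = \<gamma> * (1 + \<omega>)"
  have \<eta>: "0 < \<eta>" using \<gamma> \<omega> by (simp add: \<eta>_def)
  define xh where "xh = x - \<gamma> *\<^sub>R (grad f x - hh)"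
  define p where "p = prox (\<lambda>u. ereal \<eta> * \<psi> u) (xh - \<eta> *\<^sub>R hh)"
  define q where "q = xh - p"
  define a where "a = xh - xs"
  define b where "b = \<eta> *\<^sub>R (hh - hs)"
  define k where "k = 1 / (1 + \<omega>)"
  have k: "\<gamma> / \<eta> = k" "\<gamma> / (\<eta> * \<eta>) = k / \<eta>" "k * \<eta> = \<gamma>"
    using \<eta> \<gamma> \<omega> by (simp_all add: k_def \<eta>_def)
  have step: "\<Phi> (step (r, s) (x, h)) = (norm (a - k *\<^sub>R C\<omega> r q))\<^sup>2 + (norm (b - k *\<^sub>R C\<omega> r q))\<^sup>2" for r
  proof -
    have st: "step (r, s) (x, h) = (xh - k *\<^sub>R C\<omega> r q, hh - (k / \<eta>) *\<^sub>R C\<omega> r q)"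
      by (simp add: gradskip_step_def Let_def q_def p_def xh_def k hh flip: \<eta>_def)
    have "\<eta> *\<^sub>R (hh - (k / \<eta>) *\<^sub>R C\<omega> r q - hs) = b - k *\<^sub>R C\<omega> r q"
      using \<eta> by (simp add: b_def algebra_simps)
    then have "\<eta>\<^sup>2 * (norm (hh - (k / \<eta>) *\<^sub>R C\<omega> r q - hs))\<^sup>2 = (norm (b - k *\<^sub>R C\<omega> r q))\<^sup>2"
      by (metis norm_scaleR power2_abs power_mult_distrib)
    moreover have "xh - k *\<^sub>R C\<omega> r q - xs = a - k *\<^sub>R C\<omega> r q" by (simp add: a_def)
    moreover have "\<gamma>\<^sup>2 * (1 + \<omega>)\<^sup>2 = \<eta>\<^sup>2" by (simp add: \<eta>_def power_mult_distrib)
    ultimately show ?thesis by (simp only: st lyapunov_def prod.case)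
  qed
  have "0 \<le> (p - xs) \<bullet> (xh - \<eta> *\<^sub>R hh + \<eta> *\<^sub>R hs - p)"
    unfolding p_def by (rule prox_composite_minimizer[OF diff sc \<mu> \<psi> \<eta>])
  \<comment> \<open>Here \<open>p - xs\<close> equals \<open>a - q\<close>, and the other factor
    equals \<open>q - b\<close>.\<close>
  also have "\<dots> = q \<bullet> (a + b - q) - a \<bullet> b"
    by (simp add: q_def a_def b_def inner_diff_left inner_diff_right inner_add_left inner_add_right
        inner_commute algebra_simps)
  finally have "2 * k * (a \<bullet> b) \<le> 2 * k * (q \<bullet> (a + b - q))"
    using \<omega> by (intro mult_left_mono) (auto simp: k_def)
  then have "(norm a)\<^sup>2 + (norm b)\<^sup>2 - 2 / (1 + \<omega>) * (q \<bullet> (a + b - q)) \<le> (norm a)\<^sup>2 + (norm b)\<^sup>2 - 2 * k * (a \<bullet> b)"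
    by (simp add: k_def)
  \<comment> \<open>Completing the square: \<open>k * \<eta> = \<gamma>\<close> turns the cross term
    into that of \<open>a - \<gamma> *\<^sub>R (hh - hs)\<close>.\<close>
  also have "\<dots> = (norm (a - \<gamma> *\<^sub>R (hh - hs)))\<^sup>2 + (\<eta>\<^sup>2 - \<gamma>\<^sup>2) * (norm (hh - hs))\<^sup>2"
  proof -
    have ab: "2 * k * (a \<bullet> b) = 2 * \<gamma> * (a \<bullet> (hh - hs))" using k(3) by (simp add: b_def)
    have "(norm b)\<^sup>2 = \<eta>\<^sup>2 * (norm (hh - hs))\<^sup>2" by (simp add: b_def power_mult_distrib)
    moreover have "(norm (a - \<gamma> *\<^sub>R (hh - hs)))\<^sup>2 = (norm a)\<^sup>2 - 2 * \<gamma> * (a \<bullet> (hh - hs)) + \<gamma>\<^sup>2 * (norm (hh - hs))\<^sup>2"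
      by (simp only: power2_norm_eq_inner inner_diff_left[of a] inner_diff_right[of _ a])
        (simp add: inner_commute power2_eq_square)
    ultimately show ?thesis unfolding ab by (simp add: algebra_simps)
  qed
  also have "\<eta>\<^sup>2 - \<gamma>\<^sup>2 = \<gamma>\<^sup>2 * (\<omega> * (\<omega> + 2))"
    by (simp add: \<eta>_def power2_eq_square algebra_simps)
  \<comment> \<open>The intermediate shift enters \<open>xh\<close> as
    \<open>\<gamma> *\<^sub>R hh\<close> and cancels, so this term no longer depends on the seed
    \<open>s\<close>.\<close>
  also have "a - \<gamma> *\<^sub>R (hh - hs) = x - xs - \<gamma> *\<^sub>R (grad f x - hs)"
    by (simp add: a_def xh_def algebra_simps)
  finally have le: "(norm a)\<^sup>2 + (norm b)\<^sup>2 - 2 / (1 + \<omega>) * (q \<bullet> (a + b - q))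
    \<le> (norm (x - xs - \<gamma> *\<^sub>R (grad f x - hs)))\<^sup>2 + \<gamma>\<^sup>2 * (\<omega> * (\<omega> + 2)) * (norm (hh - hs))\<^sup>2" .
  show ?thesis
    unfolding step k_def
    using scalar_compressor_step[OF C\<omega> \<omega>, of a q b] ennreal_leI[OF le] by (rule order_trans)
qed

lemma measurable_step [measurable]:
  "(\<lambda>(y, z). step z y) \<in> measurable ((borel \<Otimes>\<^sub>M borel) \<Otimes>\<^sub>M (R \<Otimes>\<^sub>M S)) (borel \<Otimes>\<^sub>M borel)"
proof -
  have [measurable]: "grad f \<in> borel_measurable borel"
    using matrix_smooth_continuous_grad[OF sc _ smooth] \<mu>
    by (intro borel_measurable_continuous_onI) simp
  have [measurable]: "prox (\<lambda>u. ereal (\<gamma> * (1 + \<omega>)) * \<psi> u) \<in> borel_measurable borel"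
    using \<gamma> \<omega> by (intro borel_measurable_continuous_onI continuous_on_prox proper_closed_convex_scale \<psi>) simp
  have [measurable]: "(\<lambda>x. W *v x) \<in> borel_measurable borel"
    by (intro borel_measurable_continuous_onI continuous_intros)
  have C\<omega>': "(\<lambda>(r, x). C\<omega> r x) \<in> borel_measurable (R \<Otimes>\<^sub>M borel)"
    using C\<omega> by (simp add: scalar_compressor_def random_operator_def)
  have C\<Omega>': "(\<lambda>(s, x). C\<Omega> s x) \<in> borel_measurable (S \<Otimes>\<^sub>M borel)"
    using C\<Omega> by (simp add: matrix_compressor_def random_operator_def)
  \<comment> \<open>Joint measurability is recast for random seed and random input together, since
    within a step the inputs of this compressor depend on the other seed.\<close>
  have [measurable (raw)]: "(\<lambda>w. C\<omega> (r w) (x w)) \<in> borel_measurable N"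
    if "r \<in> measurable N R" "x \<in> borel_measurable N" for N :: "'z measure" and r x
    using measurable_compose[OF measurable_Pair[OF that] C\<omega>'] by simp
  have [measurable (raw)]: "(\<lambda>w. C\<Omega> (s w) (x w)) \<in> borel_measurable N"
    if "s \<in> measurable N S" "x \<in> borel_measurable N" for N :: "'z measure" and s x
    using measurable_compose[OF measurable_Pair[OF that] C\<Omega>'] by simp
  show ?thesis
    unfolding gradskip_step_def Let_def split_beta by measurable
qed

lemma measurable_lyapunov [measurable]: "\<Phi> \<in> borel_measurable (borel \<Otimes>\<^sub>M borel)"
  unfolding lyapunov_def by measurable

lemma expected_step: "(\<integral>\<^sup>+z. ennreal (\<Phi> (step z y)) \<partial>(R \<Otimes>\<^sub>M S)) \<le> ennreal (\<rho> * \<Phi> y)"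
proof -
  obtain x h where y: "y = (x, h)" by (cases y)
  define u where "u = grad f x - hs"
  define v where "v = h - hs"
  define K where "K = (norm (x - xs - \<gamma> *\<^sub>R u))\<^sup>2"
  define k where "k = \<gamma>\<^sup>2 * (\<omega> * (\<omega> + 2))"
  have k: "0 \<le> k" "0 \<le> K" using \<omega> by (simp_all add: k_def K_def)
  let ?G = "\<lambda>s. (norm (u - W *v C\<Omega> s (u - v)))\<^sup>2"
  note G = matrix_compressor_step[OF C\<Omega> \<Omega>, of u v]
  have "(\<lambda>z. (y, z)) \<in> measurable (R \<Otimes>\<^sub>M S) ((borel \<Otimes>\<^sub>M borel) \<Otimes>\<^sub>M (R \<Otimes>\<^sub>M S))"
    by (rule measurable_Pair1') (simp add: space_pair_measure)
  from measurable_compose[OF measurable_compose[OF this measurable_step] measurable_lyapunov]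
  have "(\<lambda>z. ennreal (\<Phi> (step z y))) \<in> borel_measurable (R \<Otimes>\<^sub>M S)" by simp
  \<comment> \<open>The scalar compressor is averaged first, for fixed \<open>s\<close>, because its
    input depends on \<open>s\<close> through the intermediate shift.\<close>
  then have "(\<integral>\<^sup>+z. ennreal (\<Phi> (step z y)) \<partial>(R \<Otimes>\<^sub>M S)) = (\<integral>\<^sup>+s. \<integral>\<^sup>+r. ennreal (\<Phi> (step (r, s) y)) \<partial>R \<partial>S)"
    by (rule RS.nn_integral_snd[symmetric])
  also have "\<dots> \<le> (\<integral>\<^sup>+s. ennreal (K + k * ?G s) \<partial>S)"
  proof (rule nn_integral_mono)
    fix s
    have eq: "grad f x - W *v C\<Omega> s (grad f x - h) - hs = u - W *v C\<Omega> s (u - v)"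
      by (simp add: u_def v_def)
    show "(\<integral>\<^sup>+r. ennreal (\<Phi> (step (r, s) y)) \<partial>R) \<le> ennreal (K + k * ?G s)"
      using prox_stage[OF refl, of s x h] unfolding eq by (simp only: y K_def k_def u_def[symmetric])
  qed
  also have "\<dots> = ennreal (\<integral>s. K + k * ?G s \<partial>S)"
    using G(1) k by (intro nn_integral_eq_integral) auto
  also have "(\<integral>s. K + k * ?G s \<partial>S) = K + k * (\<integral>s. ?G s \<partial>S)"
    using G(1) by (simp add: S.prob_space)
  also have "ennreal (K + k * (\<integral>s. ?G s \<partial>S)) \<le> ennreal (K + k * (u \<bullet> u - u \<bullet> (W *v u) + v \<bullet> (W *v v)))"
    using G(2) k by (intro ennreal_leI add_left_mono mult_left_mono)
  also have "\<dots> \<le> ennreal (\<rho> * \<Phi> y)"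
    unfolding y K_def k_def u_def v_def by (intro ennreal_leI deterministic_contraction)
  finally show ?thesis .
qed

section \<open>Iterating over fresh seeds\<close>

text \<open>Takes the whole seed sequence as argument instead of a sample point, so that dependence
  on the first \<open>t\<close> seeds only can be expressed and combined with independence.\<close>

definition iterate :: "real^'n \<Rightarrow> real^'n \<Rightarrow> nat \<Rightarrow> (nat \<Rightarrow> 'r \<times> 's) \<Rightarrow> (real^'n) \<times> (real^'n)" where
  "iterate x0 h0 t z =
     gradskip_plus f \<psi> \<gamma> \<omega> \<Omega> (\<lambda>k. C\<omega> (fst (z k))) (\<lambda>k. C\<Omega> (snd (z k))) x0 h0 t"

lemma iterate_simps [simp]:
  "iterate x0 h0 0 z = (x0, h0)"
  "iterate x0 h0 (Suc t) z = step (z t) (iterate x0 h0 t z)"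
  by (simp_all add: iterate_def)

lemma iterate_cong: "(\<And>k. k < t \<Longrightarrow> z k = z' k) \<Longrightarrow> iterate x0 h0 t z = iterate x0 h0 t z'"
  by (induction t) simp_all

text \<open>The bound \<open>n\<close> stays fixed while \<open>t\<close> grows, which keeps the
  product space the same throughout the induction.\<close>

lemma measurable_iterate:
  "t \<le> n \<Longrightarrow> iterate x0 h0 t \<in> measurable (PiM {..<n} (\<lambda>_. R \<Otimes>\<^sub>M S)) (borel \<Otimes>\<^sub>M borel)"
proof (induction t)
  case (Suc t)
  then have [measurable]: "iterate x0 h0 t \<in> measurable (PiM {..<n} (\<lambda>_. R \<Otimes>\<^sub>M S)) (borel \<Otimes>\<^sub>M borel)"
    and "t < n" by simp_all
  then have "(\<lambda>z. (iterate x0 h0 t z, z t))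
      \<in> measurable (PiM {..<n} (\<lambda>_. R \<Otimes>\<^sub>M S)) ((borel \<Otimes>\<^sub>M borel) \<Otimes>\<^sub>M (R \<Otimes>\<^sub>M S))"
    by (intro measurable_Pair measurable_component_singleton) auto
  from measurable_compose[OF this measurable_step] show ?case by simp
next
  case 0
  have "iterate x0 h0 0 = (\<lambda>_. (x0, h0))" by (simp add: fun_eq_iff)
  then show ?case by simp
qed

section \<open>Averaging over independent seeds and induction on the iteration\<close>

context
  fixes M :: "'w measure" and \<xi> :: "nat \<Rightarrow> 'w \<Rightarrow> 'r" and \<zeta> :: "nat \<Rightarrow> 'w \<Rightarrow> 's"
  assumes seeds: "fresh_seeds M R S \<xi> \<zeta>"
begin

interpretation M: prob_space M using seeds by (simp add: fresh_seeds_def)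

abbreviation "Z w k \<equiv> (\<xi> k w, \<zeta> k w)"

lemma measurable_seeds [measurable]: "(\<lambda>w. Z w k) \<in> measurable M (R \<Otimes>\<^sub>M S)"
  using seeds by (auto simp: fresh_seeds_def intro: measurable_Pair)

lemma iterate_restrict: "iterate x0 h0 t (restrict (Z w) {..<t}) = iterate x0 h0 t (Z w)"
  by (rule iterate_cong) simp

lemma measurable_iterate_seeds [measurable]:
  "(\<lambda>w. iterate x0 h0 t (Z w)) \<in> measurable M (borel \<Otimes>\<^sub>M borel)"
proof -
  have "(\<lambda>w. restrict (Z w) {..<t}) \<in> measurable M (PiM {..<t} (\<lambda>_. R \<Otimes>\<^sub>M S))"
    by (intro measurable_restrict measurable_seeds)
  from measurable_compose[OF this measurable_iterate[OF order_refl]] show ?thesis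
    by (simp add: iterate_restrict)
qed

text \<open>The iterate depends on the seeds before \<open>t\<close>, which are independent of seed
  \<open>t\<close>. Their joint law is therefore a product, and Tonelli allows seed \<open>t\<close>
  to be integrated separately under its law \<open>R \<Otimes>\<^sub>M S\<close>.\<close>

lemma nn_integral_fresh_seed:
  fixes g :: "((real^'n) \<times> (real^'n)) \<times> ('r \<times> 's) \<Rightarrow> ennreal"
  assumes g [measurable]: "g \<in> borel_measurable ((borel \<Otimes>\<^sub>M borel) \<Otimes>\<^sub>M (R \<Otimes>\<^sub>M S))"
  shows "(\<integral>\<^sup>+w. g (iterate x0 h0 t (Z w), Z w t) \<partial>M)
    = (\<integral>\<^sup>+w. \<integral>\<^sup>+z. g (iterate x0 h0 t (Z w), z) \<partial>(R \<Otimes>\<^sub>M S) \<partial>M)"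
proof -
  let ?P = "PiM {..<t} (\<lambda>_. R \<Otimes>\<^sub>M S)" and ?Q = "PiM {t} (\<lambda>_. R \<Otimes>\<^sub>M S)"
  \<comment> \<open>Past and present seeds become blocks over disjoint index sets, the shape in
    which a family of independent variables splits into two.\<close>
  let ?U = "\<lambda>w. restrict (Z w) {..<t}" and ?V = "\<lambda>w. restrict (Z w) {t}"
  have U [measurable]: "?U \<in> measurable M ?P" and V [measurable]: "?V \<in> measurable M ?Q"
    by (intro measurable_restrict measurable_seeds)+
  have [measurable]: "iterate x0 h0 t \<in> measurable ?P (borel \<Otimes>\<^sub>M borel)"
    by (rule measurable_iterate) simp
  have [measurable]: "(\<lambda>z. z t) \<in> measurable ?Q (R \<Otimes>\<^sub>M S)"
    by (rule measurable_component_singleton) simp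
  have "M.indep_vars (\<lambda>_. R \<Otimes>\<^sub>M S) (\<lambda>k w. Z w k) UNIV"
    using seeds by (simp add: fresh_seeds_def)
  then have "M.indep_var ?P ?U ?Q ?V"
    by (rule M.indep_var_restrict) auto
  then have UV: "distr M (?P \<Otimes>\<^sub>M ?Q) (\<lambda>w. (?U w, ?V w)) = distr M ?P ?U \<Otimes>\<^sub>M distr M ?Q ?V"
    by (simp add: M.indep_var_distribution_eq)
  interpret V: prob_space "distr M ?Q ?V" by (rule M.prob_space_distr) (rule V)
  have law: "distr M (R \<Otimes>\<^sub>M S) (\<lambda>w. Z w t) = R \<Otimes>\<^sub>M S"
    using seeds by (simp add: fresh_seeds_def)
  let ?g = "\<lambda>(p, q). g (iterate x0 h0 t p, q t)"
  have g': "?g \<in> borel_measurable (?P \<Otimes>\<^sub>M ?Q)" by measurable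
  have "(\<integral>\<^sup>+w. g (iterate x0 h0 t (Z w), Z w t) \<partial>M) = (\<integral>\<^sup>+w. ?g (?U w, ?V w) \<partial>M)"
    by (simp add: iterate_restrict)
  also have "\<dots> = integral\<^sup>N (distr M ?P ?U \<Otimes>\<^sub>M distr M ?Q ?V) ?g"
    unfolding UV[symmetric]
    by (rule nn_integral_distr[OF measurable_Pair[OF U V], symmetric]) (use g' in simp)
  also have "\<dots> = (\<integral>\<^sup>+p. \<integral>\<^sup>+q. ?g (p, q) \<partial>distr M ?Q ?V \<partial>distr M ?P ?U)"
    using g' by (intro V.nn_integral_fst[symmetric]) (simp cong: measurable_cong_sets)
  also have "\<dots> = (\<integral>\<^sup>+p. \<integral>\<^sup>+z. g (iterate x0 h0 t p, z) \<partial>(R \<Otimes>\<^sub>M S) \<partial>distr M ?P ?U)"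
  proof (rule nn_integral_cong)
    fix p assume "p \<in> space (distr M ?P ?U)"
    then have p: "p \<in> space ?P" by simp
    have [measurable]: "(\<lambda>z. g (iterate x0 h0 t p, z)) \<in> borel_measurable (R \<Otimes>\<^sub>M S)"
      by (rule measurable_compose[OF _ g]) (simp add: space_pair_measure)
    have "(\<integral>\<^sup>+q. ?g (p, q) \<partial>distr M ?Q ?V) = (\<integral>\<^sup>+w. g (iterate x0 h0 t p, Z w t) \<partial>M)"
      by (subst nn_integral_distr) simp_all
    also have "\<dots> = (\<integral>\<^sup>+z. g (iterate x0 h0 t p, z) \<partial>distr M (R \<Otimes>\<^sub>M S) (\<lambda>w. Z w t))"
      by (subst nn_integral_distr) simp_all
    finally show "(\<integral>\<^sup>+q. ?g (p, q) \<partial>distr M ?Q ?V) = (\<integral>\<^sup>+z. g (iterate x0 h0 t p, z) \<partial>(R \<Otimes>\<^sub>M S))"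
      by (simp only: law)
  qed
  also have "\<dots> = (\<integral>\<^sup>+w. \<integral>\<^sup>+z. g (iterate x0 h0 t (?U w), z) \<partial>(R \<Otimes>\<^sub>M S) \<partial>M)"
    by (rule nn_integral_distr) measurable
  finally show ?thesis by (simp only: iterate_restrict)
qed

text \<open>The induction runs on nonnegative integrals because integrability is only a consequence
  of the finite bound it produces.\<close>

lemma nn_integral_lyapunov:
  "(\<integral>\<^sup>+w. ennreal (\<Phi> (iterate x0 h0 t (Z w))) \<partial>M) \<le> ennreal (\<rho> ^ t * \<Phi> (x0, h0))"
proof (induction t)
  case 0
  show ?case by (simp add: M.emeasure_space_1)
next
  case (Suc t)
  let ?X = "\<lambda>w. iterate x0 h0 t (Z w)" and ?B = "(borel \<Otimes>\<^sub>M borel) :: ((real^'n) \<times> (real^'n)) measure"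
  let ?g = "\<lambda>(y, z). ennreal (\<Phi> (step z y))"
  have g: "?g \<in> borel_measurable (?B \<Otimes>\<^sub>M (R \<Otimes>\<^sub>M S))"
    using measurable_compose[OF measurable_compose[OF measurable_step measurable_lyapunov] measurable_ennreal]
    by (simp add: split_beta)
  have "(\<integral>\<^sup>+w. ennreal (\<Phi> (iterate x0 h0 (Suc t) (Z w))) \<partial>M) = (\<integral>\<^sup>+w. ?g (?X w, Z w t) \<partial>M)"
    by simp
  also have "\<dots> = (\<integral>\<^sup>+w. \<integral>\<^sup>+z. ?g (?X w, z) \<partial>(R \<Otimes>\<^sub>M S) \<partial>M)"
    by (rule nn_integral_fresh_seed[OF g])
  also have "\<dots> \<le> (\<integral>\<^sup>+w. ennreal (\<rho> * \<Phi> (?X w)) \<partial>M)"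
    using expected_step by (intro nn_integral_mono) simp
  also have "\<dots> = (\<integral>\<^sup>+w. ennreal \<rho> * ennreal (\<Phi> (?X w)) \<partial>M)"
    by (simp add: ennreal_mult \<rho>_nonneg lyapunov_nonneg)
  also have "\<dots> = ennreal \<rho> * (\<integral>\<^sup>+w. ennreal (\<Phi> (?X w)) \<partial>M)"
    by (rule nn_integral_cmult) measurable
  also have "\<dots> \<le> ennreal \<rho> * ennreal (\<rho> ^ t * \<Phi> (x0, h0))"
    using Suc by (rule mult_left_mono) simp
  also have "\<dots> = ennreal (\<rho> ^ Suc t * \<Phi> (x0, h0))"
    by (simp add: ennreal_mult[symmetric] \<rho>_nonneg lyapunov_nonneg mult.assoc)
  finally show ?case .
qed

lemma expected_lyapunov:
  "integrable M (\<lambda>w. \<Phi> (iterate x0 h0 t (Z w)))"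
  "(\<integral>w. \<Phi> (iterate x0 h0 t (Z w)) \<partial>M) \<le> \<rho> ^ t * \<Phi> (x0, h0)"
proof -
  have [measurable]: "(\<lambda>w. \<Phi> (iterate x0 h0 t (Z w))) \<in> borel_measurable M"
    by measurable
  show int: "integrable M (\<lambda>w. \<Phi> (iterate x0 h0 t (Z w)))"
    using nn_integral_lyapunov[of x0 h0 t]
    by (intro integrableI_nonneg) (auto simp: lyapunov_nonneg le_less_trans)
  have "ennreal (\<integral>w. \<Phi> (iterate x0 h0 t (Z w)) \<partial>M) \<le> ennreal (\<rho> ^ t * \<Phi> (x0, h0))"
    using nn_integral_lyapunov[of x0 h0 t] by (simp add: nn_integral_eq_integral[OF int] lyapunov_nonneg)
  then show "(\<integral>w. \<Phi> (iterate x0 h0 t (Z w)) \<partial>M) \<le> \<rho> ^ t * \<Phi> (x0, h0)"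
    by (simp add: ennreal_le_iff \<rho>_nonneg lyapunov_nonneg)
qed

end

end

theorem theorem4p5:
  fixes f :: "real^'n \<Rightarrow> real" and \<psi> :: "real^'n \<Rightarrow> ereal"
    and L \<Omega> :: "real^'n^'n" and \<mu> \<omega> \<gamma> \<delta> :: real
    and R :: "'r measure" and C\<omega> :: "'r \<Rightarrow> real^'n \<Rightarrow> real^'n"
    and S :: "'s measure" and C\<Omega> :: "'s \<Rightarrow> real^'n \<Rightarrow> real^'n"
    and M :: "'w measure" and \<xi> :: "nat \<Rightarrow> 'w \<Rightarrow> 'r" and \<zeta> :: "nat \<Rightarrow> 'w \<Rightarrow> 's"
    and x0 h0 :: "real^'n" and \<Psi> :: "nat \<Rightarrow> 'w \<Rightarrow> real"
  assumes "\<And>x. f differentiable (at x)"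
    and "\<mu> > 0" and "strongly_convex \<mu> f"
    and "pos_def L" and "matrix_smooth L f"
    and "proper_closed_convex \<psi>"
    and "\<omega> \<ge> 0" and "pos_semidef \<Omega>"
    and "scalar_compressor \<omega> R C\<omega>" and "matrix_compressor \<Omega> S C\<Omega>"
    and "fresh_seeds M R S \<xi> \<zeta>"
    and "0 < \<gamma>" and "\<gamma> \<le> inverse (lambda_max (L ** Omega_tilde \<omega> \<Omega>))"
  defines "\<delta> \<equiv> 1 - 1 / (1 + lambda_min \<Omega>) * (1 - 1 / (1 + \<omega>)\<^sup>2)"
    and "\<Psi> \<equiv> \<lambda>t w. lyapunov f \<psi> \<gamma> \<omega>
            (gradskip_plus f \<psi> \<gamma> \<omega> \<Omega> (\<lambda>k. C\<omega> (\<xi> k w)) (\<lambda>k. C\<Omega> (\<zeta> k w)) x0 h0 t)"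
  shows "0 \<le> \<delta> \<and> \<delta> \<le> 1 \<and>
    (\<forall>t. integrable M (\<Psi> t) \<and>
         (\<integral>w. \<Psi> t w \<partial>M) \<le> (1 - min (\<gamma> * \<mu>) \<delta>) ^ t * lyapunov f \<psi> \<gamma> \<omega> (x0, h0))"
proof -
  interpret gradskip f \<psi> L \<Omega> \<mu> \<omega> \<gamma> R C\<omega> S C\<Omega>
    using assms(1-10,12,13) by unfold_locales
  show ?thesis
    using \<delta>_bounds expected_lyapunov[OF assms(11), of x0 h0]
    by (simp add: \<delta>_def assms(14) \<rho>_def \<Psi>_def iterate_def)
qed

end
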